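(* Let $A$ be an object in a strongly honest category $\mathcal{C}$ and let $[h_1,h_2]$ be a binary decomposition of $A$, where $h_i:A\to H_i$ for $i=1,2$. Then the interval $[h_1,h_2]\!\downarrow$ of the orthoalgebra $\mathcal{D}(A)$ is isomorphic, as an orthoalgebra, to the orthoalgebra $\mathcal{D}(H_1)$.
   Context: Strongly honest categories. For morphisms $f_i:A\to A_i$ with common domain, $(f_1,\ldots,f_n)$ also denotes the induced morphism $A\to A_1\times\cdots\times A_n$; such a tuple is an $n$-ary product diagram if the $f_i$ exhibit $A$ as a product of the $A_i$. A category is strongly honest if it has finite products (including a terminal object $\Omega$); all projections of finite products are epimorphisms; and for every ternary product diagram $(f_1,f_2,f_3)$ with $f_i:A\to A_i$, the square formed by $(f_1,f_3):A\to A_1\times A_3$, $(f_2,f_3):A\to A_2\times A_3$ and the second projections $\pi_2:A_1\times A_3\to A_3$, $\pi_2:A_2\times A_3\to A_3$ is a pushout. Decompositions. Write $\tau_A:A\to\Omega$ for the unique morphism. For morphisms $f,g$ with common domain, $f\simeq g$ means there is an isomorphism $u$ with $u\circ f=g$. For finite product diagrams, $(f_1,\ldots,f_m)\approx(g_1,\ldots,g_n)$ means $m=n$ and $f_i\simeq g_i$ for all $i$. The $\approx$-class of an $n$-ary product diagram $(f_1,\ldots,f_n)$ with domain $A$ is written $[f_1,\ldots,f_n]$ and called an $n$-ary decomposition of $A$. Orthoalgebras. An orthoalgebra (OA) is a set with a partially defined binary operation $\oplus$ that is commutative and associative (in the partial sense: if one side is defined then so is the other and they are equal) and constants $0,1$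 such that (1) for each $a$ there is a unique element $a'$ with $a\oplus a'=1$; and (2) if $a\oplus a$ is defined then $a=0$. In an OA, $a\leq b$ means there is $c$ with $a\oplus c=b$. For an element $a$ of an OA, the interval $a\!\downarrow=\{b: b\leq a\}$ is an OA with constants $0,a$ under the restriction of $\oplus$ to this interval (so $b\oplus c$ is defined in $a\!\downarrow$ iff it is defined in the OA and lies in $a\!\downarrow$). An isomorphism of OAs is a bijection preserving the constants such that both it and its inverse preserve $\oplus$, where a map $\Pi$ preserves $\oplus$ if $x\oplus y$ being defined implies $\Pi(x)\oplus\Pi(y)$ is defined and equal to $\Pi(x\oplus y)$. The OA $\mathcal{D}(A)$. For an object $A$ of a strongly honest category, $\mathcal{D}(A)$ is the collection of binary decompositions of $A$. $[f_1,f_2]\oplus[g_1,g_2]$ is defined if there is a ternary decomposition $[c_1,c_2,c_3]$ of $A$ with $[f_1,f_2]=[c_1,(c_2,c_3)]$ and $[g_1,g_2]=[c_2,(c_1,c_3)]$, and in this case $[f_1,f_2]\oplus[g_1,g_2]=[(c_1,c_2),c_3]$. With this operation and the constants $0=[\tau_A,1_A]$ and $1=[1_A,\tau_A]$, $\mathcal{D}(A)$ is an OA. *)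

theory Defs
  imports Main
begin

section \<open>Categories\<close>

record ('o, 'm) category =
  Obj :: "'o set"
  Arr :: "'m set"
  Dom :: "'m \<Rightarrow> 'o"
  Cod :: "'m \<Rightarrow> 'o"
  Id :: "'o \<Rightarrow> 'm"
  Comp :: "'m \<Rightarrow> 'm \<Rightarrow> 'm"  (infixl "\<circ>\<^sub>C\<index>" 70)

definition in_hom :: "('o, 'm) category \<Rightarrow> 'm \<Rightarrow> 'o \<Rightarrow> 'o \<Rightarrow> bool" where
  "in_hom C f A B \<longleftrightarrow> f \<in> Arr C \<and> Dom C f = A \<and> Cod C f = B"

locale category =
  fixes C :: "('o, 'm) category" (structure)
  assumes dom_obj: "f \<in> Arr C \<Longrightarrow> Dom C f \<in> Obj C"
    and cod_obj: "f \<in> Arr C \<Longrightarrow> Cod C f \<in> Obj C"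
    and id_hom: "A \<in> Obj C \<Longrightarrow> in_hom C (Id C A) A A"
    and comp_hom: "in_hom C f X Y \<Longrightarrow> in_hom C g Y Z \<Longrightarrow> in_hom C (g \<circ>\<^sub>C f) X Z"
    and comp_id_left: "in_hom C f X Y \<Longrightarrow> Id C Y \<circ>\<^sub>C f = f"
    and comp_id_right: "in_hom C f X Y \<Longrightarrow> f \<circ>\<^sub>C Id C X = f"
    and comp_assoc: "in_hom C f W X \<Longrightarrow> in_hom C g X Y \<Longrightarrow> in_hom C h Y Z \<Longrightarrow>
          (h \<circ>\<^sub>C g) \<circ>\<^sub>C f = h \<circ>\<^sub>C (g \<circ>\<^sub>C f)"

definition is_iso :: "('o, 'm) category \<Rightarrow> 'm \<Rightarrow> bool" where
  "is_iso C u \<longleftrightarrow> u \<in> Arr C \<and>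
     (\<exists>v. in_hom C v (Cod C u) (Dom C u) \<and>
          Comp C v u = Id C (Dom C u) \<and> Comp C u v = Id C (Cod C u))"

definition is_epi :: "('o, 'm) category \<Rightarrow> 'm \<Rightarrow> bool" where
  "is_epi C f \<longleftrightarrow> f \<in> Arr C \<and>
     (\<forall>X g h. in_hom C g (Cod C f) X \<and> in_hom C h (Cod C f) X \<and> Comp C g f = Comp C h f
        \<longrightarrow> g = h)"

text \<open>The square \<open>p \<circ> f = q \<circ> g\<close> is a pushout of the span \<open>f, g\<close>.\<close>
definition is_pushout :: "('o, 'm) category \<Rightarrow> 'm \<Rightarrow> 'm \<Rightarrow> 'm \<Rightarrow> 'm \<Rightarrow> bool" where
  "is_pushout C f g p q \<longleftrightarrow>
     f \<in> Arr C \<and> g \<in> Arr C \<and> p \<in> Arr C \<and> q \<in> Arr C \<and>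
     Dom C f = Dom C g \<and> Dom C p = Cod C f \<and> Dom C q = Cod C g \<and> Cod C p = Cod C q \<and>
     Comp C p f = Comp C q g \<and>
     (\<forall>X a b. in_hom C a (Cod C f) X \<and> in_hom C b (Cod C g) X \<and> Comp C a f = Comp C b g
        \<longrightarrow> (\<exists>!u. in_hom C u (Cod C p) X \<and> Comp C u p = a \<and> Comp C u q = b))"

section \<open>Finite products\<close>

text \<open>An \<open>n\<close>-ary family of morphisms is a list of length \<open>n\<close>; the domain \<open>A\<close> is an explicit
  argument so that the empty list makes sense (a nullary product diagram says that \<open>A\<close> is
  terminal).\<close>
definition source :: "('o, 'm) category \<Rightarrow> 'o \<Rightarrow> 'm list \<Rightarrow> bool" where
  "source C A fs \<longleftrightarrow> A \<in> Obj C \<and> (\<forall>f \<in> set fs. f \<in> Arr C \<and> Dom C f = A)"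

definition product_diagram :: "('o, 'm) category \<Rightarrow> 'o \<Rightarrow> 'm list \<Rightarrow> bool" where
  "product_diagram C A fs \<longleftrightarrow> source C A fs \<and>
     (\<forall>B gs. source C B gs \<and> map (Cod C) gs = map (Cod C) fs
        \<longrightarrow> (\<exists>!k. in_hom C k B A \<and> map (\<lambda>f. Comp C f k) fs = gs))"

definition has_finite_products :: "('o, 'm) category \<Rightarrow> bool" where
  "has_finite_products C \<longleftrightarrow>
     (\<forall>Xs. set Xs \<subseteq> Obj C \<longrightarrow> (\<exists>P ps. product_diagram C P ps \<and> map (Cod C) ps = Xs))"

text \<open>A fixed choice of product for every finite list of objects. Everything below that uses it
  (the pushout condition, \<open>\<approx>\<close>-classes) is independent of the choice.\<close>
definition chosen_product :: "('o, 'm) category \<Rightarrow> 'o list \<Rightarrow> 'o \<times> 'm list" where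
  "chosen_product C Xs =
     (SOME (P, ps). product_diagram C P ps \<and> map (Cod C) ps = Xs)"

definition prod_obj :: "('o, 'm) category \<Rightarrow> 'o list \<Rightarrow> 'o" where
  "prod_obj C Xs = fst (chosen_product C Xs)"

definition projs :: "('o, 'm) category \<Rightarrow> 'o list \<Rightarrow> 'm list" where
  "projs C Xs = snd (chosen_product C Xs)"

text \<open>The induced morphism \<open>(f\<^sub>1, \<dots>, f\<^sub>n) : A \<rightarrow> A\<^sub>1 \<times> \<cdots> \<times> A\<^sub>n\<close>.\<close>
definition tuple :: "('o, 'm) category \<Rightarrow> 'o \<Rightarrow> 'm list \<Rightarrow> 'm" where
  "tuple C A fs =
     (THE k. in_hom C k A (prod_obj C (map (Cod C) fs)) \<and>
             map (\<lambda>p. Comp C p k) (projs C (map (Cod C) fs)) = fs)"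

definition terminal_obj :: "('o, 'm) category \<Rightarrow> 'o" where
  "terminal_obj C = prod_obj C []"

definition tau :: "('o, 'm) category \<Rightarrow> 'o \<Rightarrow> 'm" where
  "tau C A = (THE t. in_hom C t A (terminal_obj C))"

text \<open>List indices start at 0, so the second projection is \<open>projs C [X, Y] ! 1\<close>.\<close>
definition strongly_honest :: "('o, 'm) category \<Rightarrow> bool" where
  "strongly_honest C \<longleftrightarrow>
     category C \<and>
     has_finite_products C \<and>
     (\<forall>P ps. product_diagram C P ps \<longrightarrow> (\<forall>p \<in> set ps. is_epi C p)) \<and>
     (\<forall>A f1 f2 f3. product_diagram C A [f1, f2, f3] \<longrightarrow>
        is_pushout C (tuple C A [f1, f3]) (tuple C A [f2, f3])
          (projs C [Cod C f1, Cod C f3] ! 1) (projs C [Cod C f2, Cod C f3] ! 1))"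

section \<open>Decompositions\<close>

definition arr_sim :: "('o, 'm) category \<Rightarrow> 'm \<Rightarrow> 'm \<Rightarrow> bool" where
  "arr_sim C f g \<longleftrightarrow>
     (\<exists>u. is_iso C u \<and> in_hom C u (Cod C f) (Cod C g) \<and> Comp C u f = g)"

definition diagram_approx :: "('o, 'm) category \<Rightarrow> 'm list \<Rightarrow> 'm list \<Rightarrow> bool" where
  "diagram_approx C fs gs \<longleftrightarrow> list_all2 (arr_sim C) fs gs"

definition decomp :: "('o, 'm) category \<Rightarrow> 'o \<Rightarrow> 'm list \<Rightarrow> 'm list set" where
  "decomp C A fs = {gs. product_diagram C A gs \<and> diagram_approx C fs gs}"

definition decomps :: "('o, 'm) category \<Rightarrow> nat \<Rightarrow> 'o \<Rightarrow> 'm list set set" where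
  "decomps C n A = {decomp C A fs | fs. product_diagram C A fs \<and> length fs = n}"

section \<open>Orthoalgebras\<close>

text \<open>The partial operation takes values in an option type, with \<open>None\<close> meaning undefined.\<close>
record 'a oa =
  oa_carrier :: "'a set"
  oa_plus :: "'a \<Rightarrow> 'a \<Rightarrow> 'a option"  (infixl "\<oplus>\<index>" 65)
  oa_zero :: 'a
  oa_one :: 'a

locale orthoalgebra =
  fixes L :: "'a oa" (structure)
  assumes zero_closed: "oa_zero L \<in> oa_carrier L"
    and one_closed: "oa_one L \<in> oa_carrier L"
    and plus_closed: "\<lbrakk>x \<in> oa_carrier L; y \<in> oa_carrier L; x \<oplus> y = Some z\<rbrakk>
          \<Longrightarrow> z \<in> oa_carrier L"
    and plus_commute: "\<lbrakk>x \<in> oa_carrier L; y \<in> oa_carrier L\<rbrakk> \<Longrightarrow> x \<oplus> y = y \<oplus> x"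
    and plus_assoc: "\<lbrakk>x \<in> oa_carrier L; y \<in> oa_carrier L; z \<in> oa_carrier L\<rbrakk> \<Longrightarrow>
          Option.bind (x \<oplus> y) (\<lambda>u. u \<oplus> z) = Option.bind (y \<oplus> z) (\<lambda>v. x \<oplus> v)"
    and orthocomplement: "x \<in> oa_carrier L \<Longrightarrow> \<exists>!y. y \<in> oa_carrier L \<and> x \<oplus> y = Some (oa_one L)"
    and consistency: "\<lbrakk>x \<in> oa_carrier L; x \<oplus> x \<noteq> None\<rbrakk> \<Longrightarrow> x = oa_zero L"

definition oa_le :: "'a oa \<Rightarrow> 'a \<Rightarrow> 'a \<Rightarrow> bool" where
  "oa_le L a b \<longleftrightarrow> (\<exists>c \<in> oa_carrier L. oa_plus L a c = Some b)"

definition oa_down :: "'a oa \<Rightarrow> 'a \<Rightarrow> 'a set" where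
  "oa_down L a = {b \<in> oa_carrier L. oa_le L b a}"

definition oa_interval :: "'a oa \<Rightarrow> 'a \<Rightarrow> 'a oa" where
  "oa_interval L a =
     \<lparr> oa_carrier = oa_down L a,
       oa_plus = (\<lambda>b c. case oa_plus L b c of
                    None \<Rightarrow> None
                  | Some d \<Rightarrow> if b \<in> oa_down L a \<and> c \<in> oa_down L a \<and> d \<in> oa_down L a
                              then Some d else None),
       oa_zero = oa_zero L,
       oa_one = a \<rparr>"

definition preserves_plus :: "'a oa \<Rightarrow> 'b oa \<Rightarrow> ('a \<Rightarrow> 'b) \<Rightarrow> bool" where
  "preserves_plus L M \<phi> \<longleftrightarrow>
     (\<forall>x \<in> oa_carrier L. \<forall>y \<in> oa_carrier L. \<forall>z.
        oa_plus L x y = Some z \<longrightarrow> oa_plus M (\<phi> x) (\<phi> y) = Some (\<phi> z))"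

definition oa_iso :: "'a oa \<Rightarrow> 'b oa \<Rightarrow> ('a \<Rightarrow> 'b) \<Rightarrow> bool" where
  "oa_iso L M \<phi> \<longleftrightarrow>
     bij_betw \<phi> (oa_carrier L) (oa_carrier M) \<and>
     \<phi> (oa_zero L) = oa_zero M \<and> \<phi> (oa_one L) = oa_one M \<and>
     preserves_plus L M \<phi> \<and> preserves_plus M L (inv_into (oa_carrier L) \<phi>)"

definition oa_isomorphic :: "'a oa \<Rightarrow> 'b oa \<Rightarrow> bool" where
  "oa_isomorphic L M \<longleftrightarrow> orthoalgebra L \<and> orthoalgebra M \<and> (\<exists>\<phi>. oa_iso L M \<phi>)"

section \<open>The orthoalgebra of binary decompositions\<close>

text \<open>\<open>decomp_sum C A x y z\<close>: the sum of \<open>x\<close> and \<open>y\<close> is defined, with value \<open>z\<close>, by means of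
  some ternary decomposition. In a strongly honest category \<open>z\<close> does not depend on the
  witnessing ternary decomposition, so that the definite description in \<open>DA\<close> is meaningful.\<close>
definition decomp_sum ::
  "('o, 'm) category \<Rightarrow> 'o \<Rightarrow> 'm list set \<Rightarrow> 'm list set \<Rightarrow> 'm list set \<Rightarrow> bool" where
  "decomp_sum C A x y z \<longleftrightarrow>
     (\<exists>c1 c2 c3. product_diagram C A [c1, c2, c3] \<and>
        x = decomp C A [c1, tuple C A [c2, c3]] \<and>
        y = decomp C A [c2, tuple C A [c1, c3]] \<and>
        z = decomp C A [tuple C A [c1, c2], c3])"

definition DA :: "('o, 'm) category \<Rightarrow> 'o \<Rightarrow> 'm list set oa" where
  "DA C A =
     \<lparr> oa_carrier = decomps C 2 A,
       oa_plus = (\<lambda>x y. if \<exists>z. decomp_sum C A x y z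
                        then Some (THE z. decomp_sum C A x y z) else None),
       oa_zero = decomp C A [tau C A, Id C A],
       oa_one = decomp C A [Id C A, tau C A] \<rparr>"

end

theory Submission
  imports Defs "HOL-Combinatorics.Permutations"
begin

text \<open>Write \<open>[h\<^sub>1, h\<^sub>2]\<close> for the given decomposition of \<open>A\<close> and \<open>H\<close> for the codomain of \<open>h\<^sub>1\<close>. A decomposition
\<open>[k\<^sub>1, k\<^sub>2]\<close> of \<open>H\<close> splits the factor \<open>H\<close> of \<open>A\<close> further, giving the ternary decomposition
\<open>[k\<^sub>1 h\<^sub>1, k\<^sub>2 h\<^sub>1, h\<^sub>2]\<close> of \<open>A\<close>; the isomorphism sends \<open>[k\<^sub>1, k\<^sub>2]\<close> to \<open>[k\<^sub>1 h\<^sub>1, (k\<^sub>2 h\<^sub>1, h\<^sub>2)]\<close>. It has values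
in the interval because the complementary summand is \<open>[k\<^sub>2 h\<^sub>1, (k\<^sub>1 h\<^sub>1, h\<^sub>2)]\<close>. It is onto the
interval because a summand of \<open>[h\<^sub>1, h\<^sub>2]\<close> comes from a ternary decomposition \<open>[d\<^sub>1, d\<^sub>2, d\<^sub>3]\<close> with
\<open>(d\<^sub>1, d\<^sub>2) \<simeq> h\<^sub>1\<close>, so that \<open>d\<^sub>1\<close> and \<open>d\<^sub>2\<close> factor through \<open>h\<^sub>1\<close>. A ternary decomposition of \<open>H\<close>
extends in the same way to a quaternary decomposition of \<open>A\<close>, and every witness of a sum inside the
interval arises like this; hence sums are preserved and reflected.

All manipulations of products are regroupings, and they are done with one relation: \<open>t\<close> is a
tupling of a multiset \<open>M\<close> of morphisms if following \<open>t\<close> by the legs of some product diagram gives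
\<open>M\<close>. A product diagram on \<open>A\<close> is then a multiset of which the identity of \<open>A\<close> is a tupling,
\<open>f \<simeq> g\<close> says that \<open>f\<close> is a tupling of \<open>{#g#}\<close>, and a morphism to a terminal object is a tupling of
the empty multiset. In a tupling, a member may be replaced by what it is a tupling of
(\<open>tupling_expand\<close>), and conversely a submultiset by its tupling (\<open>tupling_gather\<close>). These two rules
cover associativity and symmetry of products, units, and invariance under \<open>\<simeq>\<close>.

Strong honesty enters through the preorder ``\<open>f\<close> factors through \<open>g\<close>''. The pushout condition says
that for a ternary product diagram the component \<open>f\<^sub>3\<close> is the meet of \<open>(f\<^sub>1, f\<^sub>3)\<close> and \<open>(f\<^sub>2, f\<^sub>3)\<close>
(\<open>common_factor\<close>). As all components of product diagrams are epimorphisms, mutual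
factorization of components means \<open>\<simeq>\<close>, so the two pairings determine \<open>f\<^sub>3\<close>
(\<open>third_component_unique\<close>). This makes the sum of decompositions well defined, gives the
orthoalgebra axioms for decompositions (\<open>orthoalgebra_DA\<close>), and makes the map above injective: \<open>k\<^sub>2 h\<^sub>1\<close> is
determined by \<open>h\<^sub>1 \<simeq> (k\<^sub>1 h\<^sub>1, k\<^sub>2 h\<^sub>1)\<close> and \<open>(k\<^sub>2 h\<^sub>1, h\<^sub>2)\<close>, and \<open>h\<^sub>1\<close> is epi. The axioms for the
interval follow by transport along the bijection.\<close>

section \<open>Regrouping product diagrams\<close>

lemma (in category) comp_in_Arr:
  assumes "f \<in> Arr C" "g \<in> Arr C" "Dom C g = Cod C f"
  shows "g \<circ>\<^sub>C f \<in> Arr C" "Dom C (g \<circ>\<^sub>C f) = Dom C f" "Cod C (g \<circ>\<^sub>C f) = Cod C g"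
  using comp_hom[of f "Dom C f" "Cod C f" g "Cod C g"] assms by (auto simp: in_hom_def)

lemma (in category) assoc:
  assumes "f \<in> Arr C" "g \<in> Arr C" "h \<in> Arr C" "Dom C g = Cod C f" "Dom C h = Cod C g"
  shows "(h \<circ>\<^sub>C g) \<circ>\<^sub>C f = h \<circ>\<^sub>C (g \<circ>\<^sub>C f)"
  using comp_assoc[of f "Dom C f" "Cod C f" g "Cod C g" h "Cod C h"] assms by (auto simp: in_hom_def)

lemma (in category) Id_in_Arr:
  assumes "A \<in> Obj C"
  shows "Id C A \<in> Arr C" "Dom C (Id C A) = A" "Cod C (Id C A) = A"
  using id_hom[OF assms] by (auto simp: in_hom_def)

lemma (in category) comp_Id:
  assumes "f \<in> Arr C"
  shows "Dom C f = A \<Longrightarrow> f \<circ>\<^sub>C Id C A = f" "Cod C f = B \<Longrightarrow> Id C B \<circ>\<^sub>C f = f"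
  using comp_id_right[of f "Dom C f" "Cod C f"] comp_id_left[of f "Dom C f" "Cod C f"] assms
  by (auto simp: in_hom_def)

lemma product_diagram_source:
  "product_diagram C A fs \<Longrightarrow> source C A fs"
  by (simp add: product_diagram_def)

lemma product_diagram_ex:
  assumes "product_diagram C A fs" "source C B gs" "map (Cod C) gs = map (Cod C) fs"
  obtains k where "k \<in> Arr C" "Dom C k = B" "Cod C k = A" "map (\<lambda>f. Comp C f k) fs = gs"
  using assms unfolding product_diagram_def in_hom_def by metis

lemma (in category) source_comp:
  assumes "source C T ps" "t \<in> Arr C" "Cod C t = T"
  shows "source C (Dom C t) (map (\<lambda>p. p \<circ>\<^sub>C t) ps)"
    "map (Cod C) (map (\<lambda>p. p \<circ>\<^sub>C t) ps) = map (Cod C) ps"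
  using assms by (auto simp: source_def comp_in_Arr dom_obj)

lemma (in category) product_diagram_cancel:
  assumes "product_diagram C A fs" "k \<in> Arr C" "Cod C k = A" "l \<in> Arr C" "Cod C l = A"
    "Dom C k = Dom C l" "map (\<lambda>f. f \<circ>\<^sub>C k) fs = map (\<lambda>f. f \<circ>\<^sub>C l) fs"
  shows "k = l"
proof -
  have "source C A fs" using assms(1) by (rule product_diagram_source)
  from source_comp[OF this assms(2,3)] assms(1)
  have "\<exists>!j. in_hom C j (Dom C k) A \<and> map (\<lambda>f. f \<circ>\<^sub>C j) fs = map (\<lambda>f. f \<circ>\<^sub>C k) fs"
    unfolding product_diagram_def by blast
  moreover have "in_hom C k (Dom C k) A" "in_hom C l (Dom C k) A"
    using assms by (auto simp: in_hom_def)
  ultimately show ?thesis using assms(7) by metis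
qed

lemma (in category) product_diagramI:
  assumes "source C A fs"
    and ex: "\<And>B gs. source C B gs \<Longrightarrow> map (Cod C) gs = map (Cod C) fs \<Longrightarrow>
      \<exists>k. k \<in> Arr C \<and> Dom C k = B \<and> Cod C k = A \<and> map (\<lambda>f. f \<circ>\<^sub>C k) fs = gs"
    and unique: "\<And>k l. k \<in> Arr C \<Longrightarrow> Cod C k = A \<Longrightarrow> l \<in> Arr C \<Longrightarrow> Cod C l = A \<Longrightarrow>
      Dom C k = Dom C l \<Longrightarrow> map (\<lambda>f. f \<circ>\<^sub>C k) fs = map (\<lambda>f. f \<circ>\<^sub>C l) fs \<Longrightarrow> k = l"
  shows "product_diagram C A fs"
  unfolding product_diagram_def
proof (intro conjI allI impI ex_ex1I; (elim conjE)?)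
  show "source C A fs" by fact
next
  fix B gs assume "source C B gs" "map (Cod C) gs = map (Cod C) fs"
  from ex[OF this] show "\<exists>k. in_hom C k B A \<and> map (\<lambda>f. f \<circ>\<^sub>C k) fs = gs"
    by (auto simp: in_hom_def)
next
  fix B gs k l
  assume "in_hom C k B A" "map (\<lambda>f. f \<circ>\<^sub>C k) fs = gs" "in_hom C l B A" "map (\<lambda>f. f \<circ>\<^sub>C l) fs = gs"
  then show "k = l" by (intro unique) (auto simp: in_hom_def)
qed

text \<open>The universal property speaks about families indexed by positions, so a permutation of the legs is
undone by applying the inverse permutation to the competing family.\<close>

lemma (in category) product_diagram_permute:
  assumes fs: "product_diagram C A fs" and gs: "mset gs = mset fs"
  shows "product_diagram C A gs"
proof -
  obtain p where p: "p permutes {..<length fs}" "permute_list p fs = gs"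
    using mset_eq_permutation[OF gs] by blast
  have len: "length gs = length fs" using gs by (metis size_mset)
  have pg: "inv p permutes {..<length gs}" using p permutes_inv len by metis
  have undo: "permute_list (inv p) (permute_list p xs) = xs" "permute_list p (permute_list (inv p) xs) = xs"
    if "length xs = length fs" for xs :: "'x list"
    using that p(1) permutes_inv[OF p(1)]
    by (simp_all add: permute_list_compose[symmetric] permutes_inv_o)
  show ?thesis
  proof (rule product_diagramI)
    have "set gs = set fs" using gs by (metis set_mset_mset)
    then show "source C A gs" using product_diagram_source[OF fs] by (simp add: source_def)
  next
    fix B hs assume hs: "source C B hs" "map (Cod C) hs = map (Cod C) gs"
    have lh: "length hs = length fs" using hs(2) len by (metis length_map)
    define hs' where "hs' = permute_list (inv p) hs"
    have q: "inv p permutes {..<length hs}" using p permutes_inv lh by metis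
    have "source C B hs'" using hs(1) by (simp add: source_def hs'_def set_permute_list[OF q])
    moreover have "map (Cod C) hs' = map (Cod C) fs"
    proof -
      have "map (Cod C) hs' = permute_list (inv p) (map (Cod C) gs)"
        unfolding hs'_def hs(2)[symmetric] by (rule permute_list_map[OF q, symmetric])
      also have "\<dots> = map (Cod C) (permute_list (inv p) gs)" by (rule permute_list_map[OF pg])
      finally show ?thesis using undo(1)[of fs] p(2) by simp
    qed
    ultimately obtain k where k: "k \<in> Arr C" "Dom C k = B" "Cod C k = A" "map (\<lambda>f. f \<circ>\<^sub>C k) fs = hs'"
      using fs by (elim product_diagram_ex)
    have "map (\<lambda>f. f \<circ>\<^sub>C k) gs = hs"
      using permute_list_map[OF p(1), of "\<lambda>f. f \<circ>\<^sub>C k"] k(4) undo(2)[OF lh] p(2)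
      by (simp add: hs'_def)
    with k show "\<exists>k. k \<in> Arr C \<and> Dom C k = B \<and> Cod C k = A \<and> map (\<lambda>f. f \<circ>\<^sub>C k) gs = hs" by blast
  next
    fix k l assume kl: "k \<in> Arr C" "Cod C k = A" "l \<in> Arr C" "Cod C l = A" "Dom C k = Dom C l"
      "map (\<lambda>f. f \<circ>\<^sub>C k) gs = map (\<lambda>f. f \<circ>\<^sub>C l) gs"
    have "map (\<lambda>f. f \<circ>\<^sub>C k) (permute_list (inv p) gs) = map (\<lambda>f. f \<circ>\<^sub>C l) (permute_list (inv p) gs)"
      using kl(6) permute_list_map[OF pg] by metis
    then show "k = l" using product_diagram_cancel[OF fs kl(1-5)] undo(1)[of fs] p(2) by simp
  qed
qed

text \<open>Half of the associativity of products: a product of a product and further factors is a product of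
all the factors. The list \<open>ps\<close> may have any length; length 1 replaces \<open>t\<close> by an isomorphic
morphism, and length 0 drops a morphism to a terminal object.\<close>

lemma (in category) product_diagram_expand:
  assumes A: "product_diagram C A (t # ys)" and T: "product_diagram C (Cod C t) ps"
  shows "product_diagram C A (map (\<lambda>p. p \<circ>\<^sub>C t) ps @ ys)" (is "product_diagram C A ?fs")
proof -
  have t: "t \<in> Arr C" "Dom C t = A" and ys: "source C A ys"
    using product_diagram_source[OF A] by (auto simp: source_def)
  have ps: "source C (Cod C t) ps" using T by (rule product_diagram_source)
  have tk: "map (\<lambda>p. (p \<circ>\<^sub>C t) \<circ>\<^sub>C k) ps = map (\<lambda>p. p \<circ>\<^sub>C (t \<circ>\<^sub>C k)) ps"
    if "k \<in> Arr C" "Cod C k = A" for k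
    using that t ps by (auto simp: source_def assoc)
  show ?thesis
  proof (rule product_diagramI)
    show "source C A ?fs"
      using source_comp[OF ps t(1) refl] ys t by (auto simp: source_def)
  next
    fix B gs assume gs: "source C B gs" "map (Cod C) gs = map (Cod C) ?fs"
    then obtain gs1 gs2 where g: "gs = gs1 @ gs2"
      "map (Cod C) gs1 = map (Cod C) (map (\<lambda>p. p \<circ>\<^sub>C t) ps)" "map (Cod C) gs2 = map (Cod C) ys"
      by (auto simp: map_eq_append_conv simp del: map_map)
    have B: "source C B gs1" "source C B gs2" using gs(1) g(1) by (auto simp: source_def)
    obtain m where m: "m \<in> Arr C" "Dom C m = B" "Cod C m = Cod C t" "map (\<lambda>p. p \<circ>\<^sub>C m) ps = gs1"
      using product_diagram_ex[OF T B(1)] g(2) source_comp(2)[OF ps t(1) refl] by metis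
    have "source C B (m # gs2)" using B m by (auto simp: source_def)
    then obtain k where k: "k \<in> Arr C" "Dom C k = B" "Cod C k = A"
      "map (\<lambda>f. f \<circ>\<^sub>C k) (t # ys) = m # gs2"
      using product_diagram_ex[OF A, of B "m # gs2"] g(3) m(3) by auto
    then have "map (\<lambda>f. f \<circ>\<^sub>C k) ?fs = gs" using tk[OF k(1,3)] m(4) g(1) by (simp add: comp_def)
    with k show "\<exists>k. k \<in> Arr C \<and> Dom C k = B \<and> Cod C k = A \<and> map (\<lambda>f. f \<circ>\<^sub>C k) ?fs = gs" by blast
  next
    fix k l assume kl: "k \<in> Arr C" "Cod C k = A" "l \<in> Arr C" "Cod C l = A" "Dom C k = Dom C l"
      "map (\<lambda>f. f \<circ>\<^sub>C k) ?fs = map (\<lambda>f. f \<circ>\<^sub>C l) ?fs"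
    have "map (\<lambda>p. p \<circ>\<^sub>C (t \<circ>\<^sub>C k)) ps = map (\<lambda>p. p \<circ>\<^sub>C (t \<circ>\<^sub>C l)) ps"
      using kl(6) tk[OF kl(1,2)] tk[OF kl(3,4)] by (simp add: comp_def)
    then have "t \<circ>\<^sub>C k = t \<circ>\<^sub>C l"
      by (rule product_diagram_cancel[OF T, rotated -1]) (use kl t in \<open>auto simp: comp_in_Arr\<close>)
    then show "k = l" using product_diagram_cancel[OF A kl(1-5)] kl(6) by simp
  qed
qed

text \<open>The other half of associativity: some of the factors may be collected into one.\<close>

lemma (in category) product_diagram_gather:
  assumes A: "product_diagram C A (map (\<lambda>p. p \<circ>\<^sub>C t) ps @ ys)" (is "product_diagram C A ?fs")
    and T: "product_diagram C (Cod C t) ps" and t: "t \<in> Arr C" "Dom C t = A"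
  shows "product_diagram C A (t # ys)"
proof -
  have ys: "source C A ys" using product_diagram_source[OF A] by (auto simp: source_def)
  have ps: "source C (Cod C t) ps" using T by (rule product_diagram_source)
  have tk: "map (\<lambda>p. (p \<circ>\<^sub>C t) \<circ>\<^sub>C k) ps = map (\<lambda>p. p \<circ>\<^sub>C (t \<circ>\<^sub>C k)) ps"
    if "k \<in> Arr C" "Cod C k = A" for k
    using that t ps by (auto simp: source_def assoc)
  show ?thesis
  proof (rule product_diagramI)
    show "source C A (t # ys)" using ys t by (auto simp: source_def)
  next
    fix B gs assume gs: "source C B gs" "map (Cod C) gs = map (Cod C) (t # ys)"
    then obtain m gs2 where g: "gs = m # gs2" "Cod C m = Cod C t" "map (Cod C) gs2 = map (Cod C) ys"
      by (auto simp: map_eq_Cons_conv)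
    have m: "m \<in> Arr C" "Dom C m = B" and B: "source C B gs2" using gs(1) g(1) by (auto simp: source_def)
    have "source C B (map (\<lambda>p. p \<circ>\<^sub>C m) ps @ gs2)"
      using source_comp[OF ps m(1) g(2)] B m by (auto simp: source_def)
    moreover have "map (Cod C) (map (\<lambda>p. p \<circ>\<^sub>C m) ps @ gs2) = map (Cod C) ?fs"
      using source_comp(2)[OF ps m(1) g(2)] source_comp(2)[OF ps t(1) refl] g(3) by simp
    ultimately obtain k where k: "k \<in> Arr C" "Dom C k = B" "Cod C k = A"
      "map (\<lambda>f. f \<circ>\<^sub>C k) ?fs = map (\<lambda>p. p \<circ>\<^sub>C m) ps @ gs2"
      using product_diagram_ex[OF A] by metis
    then have "map (\<lambda>p. p \<circ>\<^sub>C (t \<circ>\<^sub>C k)) ps = map (\<lambda>p. p \<circ>\<^sub>C m) ps" and k2: "map (\<lambda>f. f \<circ>\<^sub>C k) ys = gs2"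
      using tk[OF k(1,3)] by (auto simp: comp_def)
    then have "t \<circ>\<^sub>C k = m"
      by (intro product_diagram_cancel[OF T]) (use k m t g in \<open>auto simp: comp_in_Arr\<close>)
    with k k2 g show "\<exists>k. k \<in> Arr C \<and> Dom C k = B \<and> Cod C k = A \<and> map (\<lambda>f. f \<circ>\<^sub>C k) (t # ys) = gs"
      by auto
  next
    fix k l assume kl: "k \<in> Arr C" "Cod C k = A" "l \<in> Arr C" "Cod C l = A" "Dom C k = Dom C l"
      "map (\<lambda>f. f \<circ>\<^sub>C k) (t # ys) = map (\<lambda>f. f \<circ>\<^sub>C l) (t # ys)"
    then show "k = l"
      using product_diagram_cancel[OF A kl(1-5)] tk[OF kl(1,2)] tk[OF kl(3,4)] by (simp add: comp_def)
  qed
qed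

lemma (in category) product_diagram_unary:
  "product_diagram C A [u] \<longleftrightarrow> is_iso C u \<and> Dom C u = A"
proof
  assume u: "product_diagram C A [u]"
  then have uA: "u \<in> Arr C" "Dom C u = A" "A \<in> Obj C" using product_diagram_source[OF u] by (auto simp: source_def)
  have "source C (Cod C u) [Id C (Cod C u)]" using uA by (auto simp: source_def Id_in_Arr cod_obj)
  then obtain v where v: "v \<in> Arr C" "Dom C v = Cod C u" "Cod C v = A" "u \<circ>\<^sub>C v = Id C (Cod C u)"
    using product_diagram_ex[OF u \<open>source C (Cod C u) [Id C (Cod C u)]\<close>] uA
    by (auto simp: Id_in_Arr cod_obj)
  have "v \<circ>\<^sub>C u = Id C A"
  proof (rule product_diagram_cancel[OF u])
    show "map (\<lambda>f. f \<circ>\<^sub>C (v \<circ>\<^sub>C u)) [u] = map (\<lambda>f. f \<circ>\<^sub>C Id C A) [u]"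
      using assoc[of u v u] v uA by (simp add: comp_Id)
  qed (use v uA in \<open>auto simp: comp_in_Arr Id_in_Arr\<close>)
  then show "is_iso C u \<and> Dom C u = A" using v uA by (auto simp: is_iso_def in_hom_def)
next
  assume "is_iso C u \<and> Dom C u = A"
  then obtain v where u: "u \<in> Arr C" "Dom C u = A" and v: "v \<in> Arr C" "Dom C v = Cod C u" "Cod C v = A"
    "v \<circ>\<^sub>C u = Id C A" "u \<circ>\<^sub>C v = Id C (Cod C u)"
    by (auto simp: is_iso_def in_hom_def)
  show "product_diagram C A [u]"
  proof (rule product_diagramI)
    show "source C A [u]" using u by (auto simp: source_def dom_obj)
  next
    fix B gs assume "source C B gs" "map (Cod C) gs = map (Cod C) [u]"
    then obtain g where g: "gs = [g]" "g \<in> Arr C" "Dom C g = B" "Cod C g = Cod C u"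
      by (auto simp: source_def)
    then have "u \<circ>\<^sub>C (v \<circ>\<^sub>C g) = g" using u v assoc[of g v u] by (simp add: comp_Id)
    with g u v show "\<exists>k. k \<in> Arr C \<and> Dom C k = B \<and> Cod C k = A \<and> map (\<lambda>f. f \<circ>\<^sub>C k) [u] = gs"
      by (intro exI[of _ "v \<circ>\<^sub>C g"]) (auto simp: comp_in_Arr)
  next
    fix k l assume kl: "k \<in> Arr C" "Cod C k = A" "l \<in> Arr C" "Cod C l = A" "Dom C k = Dom C l"
      "map (\<lambda>f. f \<circ>\<^sub>C k) [u] = map (\<lambda>f. f \<circ>\<^sub>C l) [u]"
    have "k = v \<circ>\<^sub>C (u \<circ>\<^sub>C k)" "l = v \<circ>\<^sub>C (u \<circ>\<^sub>C l)"
      using assoc[of k u v] assoc[of l u v] kl u v by (simp_all add: comp_Id)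
    with kl(6) show "k = l" by simp
  qed
qed

section \<open>Tuplings\<close>

text \<open>The relation \<open>t \<simeq> (f\<^sub>1, \<dots>, f\<^sub>n)\<close>, without a chosen product and without an order of the \<open>f\<^sub>i\<close>. It
is stable under \<open>\<simeq>\<close> on both sides, which is what calculations with \<open>\<approx>\<close>-classes need. Since the
objects are recovered from \<open>t\<close>, even the empty multiset has a meaning.\<close>

definition tupling :: "('o, 'm) category \<Rightarrow> 'm \<Rightarrow> 'm multiset \<Rightarrow> bool" where
  "tupling C t M \<longleftrightarrow> t \<in> Arr C \<and>
     (\<exists>ps. product_diagram C (Cod C t) ps \<and> mset (map (\<lambda>p. Comp C p t) ps) = M)"

lemma tupling_Arr: "tupling C t M \<Longrightarrow> t \<in> Arr C"
  by (simp add: tupling_def)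

lemma mset_map_reorder:
  assumes "mset (map f xs) = mset ys"
  obtains xs' where "mset xs' = mset xs" "map f xs' = ys"
proof -
  obtain p where p: "p permutes {..<length (map f xs)}" "permute_list p (map f xs) = ys"
    using mset_eq_permutation[OF assms[symmetric]] by blast
  then show thesis
    using that[of "permute_list p xs"] by (simp add: permute_list_map)
qed

text \<open>Chooses the product diagram so that its legs come in a prescribed order.\<close>

lemma (in category) tupling_listE:
  assumes "tupling C t M" "mset ys = M"
  obtains ps where "product_diagram C (Cod C t) ps" "map (\<lambda>p. p \<circ>\<^sub>C t) ps = ys"
proof -
  obtain ps where ps: "product_diagram C (Cod C t) ps" "mset (map (\<lambda>p. p \<circ>\<^sub>C t) ps) = mset ys"
    using assms by (auto simp: tupling_def)
  obtain qs where "mset qs = mset ps" "map (\<lambda>p. p \<circ>\<^sub>C t) qs = ys"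
    using mset_map_reorder[OF ps(2)] by blast
  then show thesis using that product_diagram_permute[OF ps(1)] by blast
qed

lemma (in category) tupling_comp:
  assumes "product_diagram C (Cod C t) ps" "t \<in> Arr C"
  shows "tupling C t (mset (map (\<lambda>p. p \<circ>\<^sub>C t) ps))"
  using assms by (auto simp: tupling_def)

text \<open>The product diagrams on \<open>A\<close> are the decompositions of the identity, so every statement about them
becomes one about tuplings.\<close>

lemma (in category) product_diagram_iff_tupling:
  assumes "A \<in> Obj C"
  shows "product_diagram C A fs \<longleftrightarrow> tupling C (Id C A) (mset fs)"
proof
  assume fs: "product_diagram C A fs"
  then have "map (\<lambda>f. f \<circ>\<^sub>C Id C A) fs = fs"
    using product_diagram_source[OF fs] by (auto simp: source_def comp_Id intro: map_idI)
  then show "tupling C (Id C A) (mset fs)"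
    using tupling_comp[of "Id C A" fs] fs assms by (simp add: Id_in_Arr)
next
  assume "tupling C (Id C A) (mset fs)"
  then obtain ps where ps: "product_diagram C A ps" "map (\<lambda>p. p \<circ>\<^sub>C Id C A) ps = fs"
    using tupling_listE[of "Id C A" "mset fs" fs] assms by (auto simp: Id_in_Arr)
  moreover have "map (\<lambda>p. p \<circ>\<^sub>C Id C A) ps = ps"
    using product_diagram_source[OF ps(1)] by (auto simp: source_def comp_Id intro: map_idI)
  ultimately show "product_diagram C A fs" by simp
qed

lemma (in category) tupling_mem:
  assumes "tupling C t M" "f \<in># M"
  shows "f \<in> Arr C" "Dom C f = Dom C t" "\<exists>u. in_hom C u (Cod C t) (Cod C f) \<and> f = u \<circ>\<^sub>C t"
proof -
  obtain ps where ps: "product_diagram C (Cod C t) ps" "mset (map (\<lambda>p. p \<circ>\<^sub>C t) ps) = M" "t \<in> Arr C"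
    using assms by (auto simp: tupling_def)
  then obtain p where "p \<in> set ps" "f = p \<circ>\<^sub>C t" using assms(2) by auto
  then show "f \<in> Arr C" "Dom C f = Dom C t" "\<exists>u. in_hom C u (Cod C t) (Cod C f) \<and> f = u \<circ>\<^sub>C t"
    using product_diagram_source[OF ps(1)] ps(3) by (auto simp: source_def comp_in_Arr in_hom_def)
qed

lemma (in category) tupling_expand:
  assumes t: "tupling C t K" and s: "tupling C s N" and K: "K = add_mset s M"
  shows "tupling C t (N + M)"
proof -
  obtain ys where ys: "mset ys = M" by (metis ex_mset)
  obtain qs where qs: "product_diagram C (Cod C t) qs" "map (\<lambda>q. q \<circ>\<^sub>C t) qs = s # ys"
    using tupling_listE[OF t, of "s # ys"] ys K by auto
  obtain ps where ps: "product_diagram C (Cod C s) ps" "mset (map (\<lambda>p. p \<circ>\<^sub>C s) ps) = N"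
    using s by (auto simp: tupling_def)
  obtain q qs2 where q: "qs = q # qs2" "q \<circ>\<^sub>C t = s" "map (\<lambda>q. q \<circ>\<^sub>C t) qs2 = ys"
    using qs(2) by (auto simp: map_eq_Cons_conv)
  have t': "t \<in> Arr C" using t by (rule tupling_Arr)
  have qA: "q \<in> Arr C" "Dom C q = Cod C t"
    using product_diagram_source[OF qs(1)] q(1) by (auto simp: source_def)
  then have Cs: "Cod C s = Cod C q" using q(2) t' by (auto simp: comp_in_Arr)
  have "map (\<lambda>p. (p \<circ>\<^sub>C q) \<circ>\<^sub>C t) ps = map (\<lambda>p. p \<circ>\<^sub>C s) ps"
    using product_diagram_source[OF ps(1)] qA t' q(2) Cs by (auto simp: source_def assoc)
  then have "mset (map (\<lambda>p. p \<circ>\<^sub>C t) (map (\<lambda>p. p \<circ>\<^sub>C q) ps @ qs2)) = N + M"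
    unfolding map_append mset_append map_map comp_def q(3) ps(2) ys[symmetric] using ps(2) by metis
  then show ?thesis
    using product_diagram_expand[OF qs(1)[unfolded q(1)] ps(1)[unfolded Cs]] t' tupling_comp by metis
qed

text \<open>A tupling of \<open>N + M\<close> has legs for \<open>N\<close> and legs for \<open>M\<close>. The former define a morphism \<open>r\<close> into the
codomain of \<open>s\<close>, and \<open>r \<circ> t = s\<close> by the universal property there. The domains have to be compared
explicitly because an empty \<open>N\<close> says nothing about the domain of \<open>s\<close>.\<close>

lemma (in category) tupling_gather:
  assumes t: "tupling C t K" and s: "tupling C s N" and K: "K = N + M" and dom: "Dom C s = Dom C t"
  shows "tupling C t (add_mset s M)"
proof -
  obtain ys where ys: "mset ys = M" by (metis ex_mset)
  obtain ps where ps: "product_diagram C (Cod C s) ps" "mset (map (\<lambda>p. p \<circ>\<^sub>C s) ps) = N"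
    using s by (auto simp: tupling_def)
  obtain qs where qs: "product_diagram C (Cod C t) qs"
    "map (\<lambda>q. q \<circ>\<^sub>C t) qs = map (\<lambda>p. p \<circ>\<^sub>C s) ps @ ys"
    using tupling_listE[OF t, of "map (\<lambda>p. p \<circ>\<^sub>C s) ps @ ys"] ys K ps(2) by auto
  obtain qs1 qs2 where q: "qs = qs1 @ qs2" "map (\<lambda>q. q \<circ>\<^sub>C t) qs1 = map (\<lambda>p. p \<circ>\<^sub>C s) ps"
    "map (\<lambda>q. q \<circ>\<^sub>C t) qs2 = ys"
    using qs(2) by (metis map_eq_append_conv)
  have ts: "t \<in> Arr C" "s \<in> Arr C" using t s by (auto simp: tupling_Arr)
  have sq: "source C (Cod C t) qs1" and sp: "source C (Cod C s) ps"
    using product_diagram_source[OF qs(1)] product_diagram_source[OF ps(1)] q(1) by (auto simp: source_def)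
  have "map (Cod C) qs1 = map (Cod C) ps"
    using source_comp(2)[OF sq ts(1) refl] source_comp(2)[OF sp ts(2) refl] q(2) by simp
  then obtain r where r: "r \<in> Arr C" "Dom C r = Cod C t" "Cod C r = Cod C s"
    "map (\<lambda>p. p \<circ>\<^sub>C r) ps = qs1"
    using product_diagram_ex[OF ps(1) sq] by metis
  have rt: "r \<circ>\<^sub>C t = s"
  proof (rule product_diagram_cancel[OF ps(1)])
    have "map (\<lambda>p. p \<circ>\<^sub>C (r \<circ>\<^sub>C t)) ps = map (\<lambda>p. (p \<circ>\<^sub>C r) \<circ>\<^sub>C t) ps"
      using sp r ts by (auto simp: source_def assoc)
    also have "\<dots> = map (\<lambda>q. q \<circ>\<^sub>C t) qs1" by (simp add: r(4)[symmetric] comp_def)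
    finally show "map (\<lambda>p. p \<circ>\<^sub>C (r \<circ>\<^sub>C t)) ps = map (\<lambda>p. p \<circ>\<^sub>C s) ps" using q(2) by simp
  qed (use r ts dom in \<open>auto simp: comp_in_Arr\<close>)
  have "product_diagram C (Cod C t) (r # qs2)"
    using product_diagram_gather[of "Cod C t" r ps qs2] qs(1) ps(1) r q(1) by simp
  then have "tupling C t (mset (map (\<lambda>q. q \<circ>\<^sub>C t) (r # qs2)))" using ts(1) by (rule tupling_comp)
  then show ?thesis using rt q(3) ys by simp
qed

text \<open>Unary product diagrams are isomorphisms.\<close>

lemma (in category) tupling_single:
  assumes "t \<in> Arr C" "f \<in> Arr C"
  shows "tupling C t {#f#} \<longleftrightarrow> arr_sim C t f"
proof
  assume "tupling C t {#f#}"
  then obtain ps where ps: "product_diagram C (Cod C t) ps" "map (\<lambda>p. p \<circ>\<^sub>C t) ps = [f]"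
    using tupling_listE[of t "{#f#}" "[f]"] by auto
  then obtain u where u: "ps = [u]" "u \<circ>\<^sub>C t = f" by (auto simp: map_eq_Cons_conv)
  then have "is_iso C u" "Dom C u = Cod C t" "u \<in> Arr C"
    using ps(1) product_diagram_unary by (auto simp: is_iso_def)
  then show "arr_sim C t f" using u assms by (auto simp: arr_sim_def in_hom_def comp_in_Arr)
next
  assume "arr_sim C t f"
  then obtain u where "is_iso C u" "in_hom C u (Cod C t) (Cod C f)" "u \<circ>\<^sub>C t = f" by (auto simp: arr_sim_def)
  then show "tupling C t {#f#}"
    using tupling_comp[of t "[u]"] assms by (auto simp: product_diagram_unary in_hom_def)
qed

lemma (in category) arr_sim_sym:
  assumes "arr_sim C f g" "f \<in> Arr C"
  shows "arr_sim C g f"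
proof -
  obtain u v where u: "in_hom C u (Cod C f) (Cod C g)" "u \<circ>\<^sub>C f = g" and
    v: "in_hom C v (Cod C u) (Dom C u)" "v \<circ>\<^sub>C u = Id C (Dom C u)" "u \<circ>\<^sub>C v = Id C (Cod C u)"
    using assms by (auto simp: arr_sim_def is_iso_def)
  then have "is_iso C v" "in_hom C v (Cod C g) (Cod C f)" by (auto simp: is_iso_def in_hom_def)
  moreover have "v \<circ>\<^sub>C g = f" using assoc[of f u v] u v assms by (auto simp: in_hom_def comp_Id)
  ultimately show ?thesis by (auto simp: arr_sim_def)
qed

lemma (in category) arr_sim_refl:
  assumes "f \<in> Arr C" shows "arr_sim C f f"
proof -
  have I: "in_hom C (Id C (Cod C f)) (Cod C f) (Cod C f)" using assms by (simp add: id_hom cod_obj)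
  then have "Id C (Cod C f) \<circ>\<^sub>C Id C (Cod C f) = Id C (Cod C f)" by (rule comp_id_left)
  with I have "is_iso C (Id C (Cod C f))" by (auto simp: is_iso_def in_hom_def)
  with I assms show ?thesis unfolding arr_sim_def by (blast intro: comp_Id(2))
qed

lemma (in category) arr_sim_Arr:
  assumes "f \<in> Arr C" "arr_sim C f g"
  shows "g \<in> Arr C" "Dom C g = Dom C f"
  using assms by (auto simp: arr_sim_def in_hom_def comp_in_Arr)

text \<open>Gathering all of \<open>M\<close> turns the tupling \<open>s\<close> of \<open>M\<close> into a tupling of the single morphism \<open>t\<close>.\<close>

lemma (in category) tupling_unique:
  assumes "tupling C s M" "tupling C t M" "Dom C s = Dom C t"
  shows "arr_sim C s t"
  using tupling_gather[OF assms(1,2), of "{#}"] assms tupling_single by (auto simp: tupling_Arr)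

lemma (in category) tupling_sim:
  assumes "tupling C s M" "arr_sim C s t"
  shows "tupling C t M"
proof -
  have s: "s \<in> Arr C" using assms(1) by (rule tupling_Arr)
  have t: "t \<in> Arr C" using arr_sim_Arr(1)[OF s assms(2)] .
  have "tupling C t {#s#}" using arr_sim_sym[OF assms(2) s] tupling_single s t by blast
  from tupling_expand[OF this assms(1)] show ?thesis by simp
qed

lemma (in category) tupling_replace:
  assumes "tupling C t (add_mset f M)" "arr_sim C f g"
  shows "tupling C t (add_mset g M)"
proof -
  have f: "f \<in> Arr C" using tupling_mem(1)[OF assms(1)] by simp
  have g: "g \<in> Arr C" using arr_sim_Arr(1)[OF f assms(2)] .
  have "tupling C f {#g#}" using assms(2) tupling_single f g by blast
  from tupling_expand[OF assms(1) this refl] show ?thesis by simp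
qed

lemma (in category) arr_sim_trans:
  assumes "arr_sim C f g" "arr_sim C g h" "f \<in> Arr C"
  shows "arr_sim C f h"
proof -
  have g: "g \<in> Arr C" using arr_sim_Arr(1)[OF assms(3,1)] .
  have h: "h \<in> Arr C" using arr_sim_Arr(1)[OF g assms(2)] .
  have "tupling C f {#g#}" using assms g tupling_single by blast
  from tupling_replace[OF this assms(2)] show ?thesis using assms h tupling_single by blast
qed

lemma (in category) tupling_precomp:
  assumes "tupling C t M" "e \<in> Arr C" "Cod C e = Dom C t"
  shows "tupling C (t \<circ>\<^sub>C e) (image_mset (\<lambda>f. f \<circ>\<^sub>C e) M)"
proof -
  obtain ps where ps: "product_diagram C (Cod C t) ps" "mset (map (\<lambda>p. p \<circ>\<^sub>C t) ps) = M" "t \<in> Arr C"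
    using assms by (auto simp: tupling_def)
  have "map (\<lambda>p. p \<circ>\<^sub>C (t \<circ>\<^sub>C e)) ps = map (\<lambda>f. f \<circ>\<^sub>C e) (map (\<lambda>p. p \<circ>\<^sub>C t) ps)"
    using product_diagram_source[OF ps(1)] ps(3) assms by (auto simp: source_def assoc)
  then have "mset (map (\<lambda>p. p \<circ>\<^sub>C (t \<circ>\<^sub>C e)) ps) = image_mset (\<lambda>f. f \<circ>\<^sub>C e) M"
    using ps(2) by (metis mset_map)
  then show ?thesis using tupling_comp[of "t \<circ>\<^sub>C e" ps] ps assms by (simp add: comp_in_Arr)
qed

section \<open>Strongly honest categories\<close>

locale strongly_honest_category = category C for C :: "('o, 'm) category" (structure) +
  assumes honest: "strongly_honest C"
begin

lemma chosen_product:
  assumes "set Xs \<subseteq> Obj C"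
  shows "product_diagram C (prod_obj C Xs) (projs C Xs)" "map (Cod C) (projs C Xs) = Xs"
proof -
  obtain P ps where "product_diagram C P ps \<and> map (Cod C) ps = Xs"
    using honest assms by (auto simp: strongly_honest_def has_finite_products_def)
  then have "case (P, ps) of (P, ps) \<Rightarrow> product_diagram C P ps \<and> map (Cod C) ps = Xs" by simp
  then have "case chosen_product C Xs of (P, ps) \<Rightarrow> product_diagram C P ps \<and> map (Cod C) ps = Xs"
    unfolding chosen_product_def by (rule someI)
  then show "product_diagram C (prod_obj C Xs) (projs C Xs)" "map (Cod C) (projs C Xs) = Xs"
    by (auto simp: prod_obj_def projs_def split_beta)
qed

lemma tuple:
  assumes "source C A fs"
  shows "tuple C A fs \<in> Arr C" "Dom C (tuple C A fs) = A"
    "Cod C (tuple C A fs) = prod_obj C (map (Cod C) fs)"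
    "map (\<lambda>p. p \<circ>\<^sub>C tuple C A fs) (projs C (map (Cod C) fs)) = fs"
    "tupling C (tuple C A fs) (mset fs)"
proof -
  have "set (map (Cod C) fs) \<subseteq> Obj C" using assms by (auto simp: source_def cod_obj)
  note P = chosen_product[OF this]
  have "\<exists>!k. in_hom C k A (prod_obj C (map (Cod C) fs)) \<and>
      map (\<lambda>p. p \<circ>\<^sub>C k) (projs C (map (Cod C) fs)) = fs"
    using P assms unfolding product_diagram_def by simp
  from theI'[OF this] have t: "in_hom C (tuple C A fs) A (prod_obj C (map (Cod C) fs))"
    "map (\<lambda>p. p \<circ>\<^sub>C tuple C A fs) (projs C (map (Cod C) fs)) = fs"
    by (auto simp: tuple_def)
  then show "tuple C A fs \<in> Arr C" "Dom C (tuple C A fs) = A"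
    "Cod C (tuple C A fs) = prod_obj C (map (Cod C) fs)"
    "map (\<lambda>p. p \<circ>\<^sub>C tuple C A fs) (projs C (map (Cod C) fs)) = fs"
    by (auto simp: in_hom_def)
  with P tupling_comp[of "tuple C A fs" "projs C (map (Cod C) fs)"]
  show "tupling C (tuple C A fs) (mset fs)" by simp
qed

lemma pairing_exists:
  assumes "f \<in> Arr C" "g \<in> Arr C" "Dom C f = A" "Dom C g = A"
  obtains t where "tupling C t {#f, g#}" "Dom C t = A"
  using tuple[of A "[f, g]"] assms by (force simp: source_def dom_obj)

lemma tau:
  assumes "A \<in> Obj C"
  shows "tau C A \<in> Arr C" "Dom C (tau C A) = A" "Cod C (tau C A) = terminal_obj C"
    "tupling C (tau C A) {#}"
    "\<And>t. t \<in> Arr C \<Longrightarrow> Dom C t = A \<Longrightarrow> Cod C t = terminal_obj C \<Longrightarrow> t = tau C A"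
proof -
  have P: "product_diagram C (terminal_obj C) []"
    using chosen_product[of "[]"] by (simp add: terminal_obj_def)
  then have ex: "\<exists>!t. in_hom C t A (terminal_obj C)"
    using assms by (auto simp: product_diagram_def source_def)
  from theI'[OF this] have t: "in_hom C (tau C A) A (terminal_obj C)" by (simp add: tau_def)
  then show *: "tau C A \<in> Arr C" "Dom C (tau C A) = A" "Cod C (tau C A) = terminal_obj C"
    by (auto simp: in_hom_def)
  then show "tupling C (tau C A) {#}" using tupling_comp[of "tau C A" "[]"] P by simp
  show "\<And>t. t \<in> Arr C \<Longrightarrow> Dom C t = A \<Longrightarrow> Cod C t = terminal_obj C \<Longrightarrow> t = tau C A"
    using ex t by (auto simp: in_hom_def)
qed

end

section \<open>Factorization through a morphism and decomposition classes\<close>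

definition factors :: "('o, 'm) category \<Rightarrow> 'm \<Rightarrow> 'm \<Rightarrow> bool" where
  "factors C f g \<longleftrightarrow> (\<exists>u. in_hom C u (Cod C g) (Cod C f) \<and> f = Comp C u g)"

context category begin

lemma factors_refl: "f \<in> Arr C \<Longrightarrow> factors C f f"
  unfolding factors_def using comp_Id(2)[of f "Cod C f"] id_hom[of "Cod C f"] cod_obj[of f] by metis

lemma factors_trans:
  assumes "factors C f g" "factors C g h" "h \<in> Arr C"
  shows "factors C f h"
proof -
  obtain u v where "in_hom C u (Cod C g) (Cod C f)" "f = u \<circ>\<^sub>C g"
    "in_hom C v (Cod C h) (Cod C g)" "g = v \<circ>\<^sub>C h"
    using assms by (auto simp: factors_def)
  note uv = this
  then have "in_hom C (u \<circ>\<^sub>C v) (Cod C h) (Cod C f)" by (blast intro: comp_hom)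
  moreover have "f = (u \<circ>\<^sub>C v) \<circ>\<^sub>C h"
    using comp_assoc[of h "Dom C h" "Cod C h" v "Cod C g" u "Cod C f"] uv assms(3)
    by (simp add: in_hom_def)
  ultimately show ?thesis by (auto simp: factors_def)
qed

lemma factors_sim: "arr_sim C f g \<Longrightarrow> factors C g f"
  by (auto simp: arr_sim_def factors_def)

lemma tupling_factors: "tupling C t M \<Longrightarrow> f \<in># M \<Longrightarrow> factors C f t"
  using tupling_mem(3) by (auto simp: factors_def)

lemma epi_cancel:
  assumes "is_epi C e" "in_hom C k (Cod C e) X" "in_hom C l (Cod C e) X" "k \<circ>\<^sub>C e = l \<circ>\<^sub>C e"
  shows "k = l"
  using assms unfolding is_epi_def by blast

text \<open>The two mediating morphisms are mutually inverse after cancelling the epimorphisms.\<close>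

lemma factors_antisym:
  assumes "is_epi C f" "is_epi C g" "factors C f g" "factors C g f"
  shows "arr_sim C f g"
proof -
  have fg: "in_hom C f (Dom C f) (Cod C f)" "in_hom C g (Dom C g) (Cod C g)"
    using assms by (auto simp: is_epi_def in_hom_def)
  obtain u v where u: "in_hom C u (Cod C g) (Cod C f)" "f = u \<circ>\<^sub>C g"
    and v: "in_hom C v (Cod C f) (Cod C g)" "g = v \<circ>\<^sub>C f"
    using assms(3,4) unfolding factors_def by blast
  have I: "in_hom C (Id C (Cod C f)) (Cod C f) (Cod C f)" "in_hom C (Id C (Cod C g)) (Cod C g) (Cod C g)"
    using fg id_hom cod_obj unfolding in_hom_def by blast+
  have "(v \<circ>\<^sub>C u) \<circ>\<^sub>C g = Id C (Cod C g) \<circ>\<^sub>C g"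
    unfolding comp_assoc[OF fg(2) u(1) v(1)] comp_id_left[OF fg(2)] u(2)[symmetric] v(2)[symmetric] ..
  then have vu: "v \<circ>\<^sub>C u = Id C (Cod C g)"
    by (rule epi_cancel[OF assms(2) comp_hom[OF u(1) v(1)] I(2)])
  have "(u \<circ>\<^sub>C v) \<circ>\<^sub>C f = Id C (Cod C f) \<circ>\<^sub>C f"
    unfolding comp_assoc[OF fg(1) v(1) u(1)] comp_id_left[OF fg(1)] v(2)[symmetric] u(2)[symmetric] ..
  then have "u \<circ>\<^sub>C v = Id C (Cod C f)"
    by (rule epi_cancel[OF assms(1) comp_hom[OF v(1) u(1)] I(1)])
  with u(1) v(1) vu have "is_iso C v" by (auto simp: is_iso_def in_hom_def)
  with v show ?thesis unfolding arr_sim_def by metis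
qed

text \<open>The isomorphism between the composites is already one between \<open>k\<close> and \<open>l\<close>.\<close>

lemma epi_reflects_sim:
  assumes e: "is_epi C e" and k: "k \<in> Arr C" "Dom C k = Cod C e" and l: "l \<in> Arr C" "Dom C l = Cod C e"
    and sim: "arr_sim C (k \<circ>\<^sub>C e) (l \<circ>\<^sub>C e)"
  shows "arr_sim C k l"
proof -
  have h: "in_hom C e (Dom C e) (Cod C e)" "in_hom C k (Cod C e) (Cod C k)" "in_hom C l (Cod C e) (Cod C l)"
    using e k l by (auto simp: is_epi_def in_hom_def)
  obtain u where u: "is_iso C u" "in_hom C u (Cod C k) (Cod C l)" "u \<circ>\<^sub>C (k \<circ>\<^sub>C e) = l \<circ>\<^sub>C e"
    using sim comp_hom[OF h(1,2)] comp_hom[OF h(1,3)] by (auto simp: arr_sim_def in_hom_def)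
  have "(u \<circ>\<^sub>C k) \<circ>\<^sub>C e = l \<circ>\<^sub>C e" using comp_assoc[OF h(1,2) u(2)] u(3) by simp
  then have "u \<circ>\<^sub>C k = l" by (rule epi_cancel[OF e comp_hom[OF h(2) u(2)] h(3)])
  with u show ?thesis unfolding arr_sim_def by blast
qed

lemma arr_sim_comp:
  assumes sim: "arr_sim C k l" and k: "k \<in> Arr C" and e: "e \<in> Arr C" "Cod C e = Dom C k"
  shows "arr_sim C (k \<circ>\<^sub>C e) (l \<circ>\<^sub>C e)"
proof -
  have h: "in_hom C e (Dom C e) (Dom C k)" "in_hom C k (Dom C k) (Cod C k)" "in_hom C l (Dom C k) (Cod C l)"
    using assms arr_sim_Arr[OF k sim] by (auto simp: in_hom_def)
  obtain u where u: "is_iso C u" "in_hom C u (Cod C k) (Cod C l)" "u \<circ>\<^sub>C k = l"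
    using sim by (auto simp: arr_sim_def)
  have "u \<circ>\<^sub>C (k \<circ>\<^sub>C e) = l \<circ>\<^sub>C e" using comp_assoc[OF h(1,2) u(2)] u(3) by simp
  moreover have "Cod C (k \<circ>\<^sub>C e) = Cod C k" "Cod C (l \<circ>\<^sub>C e) = Cod C l"
    using comp_hom[OF h(1,2)] comp_hom[OF h(1,3)] by (auto simp: in_hom_def)
  ultimately show ?thesis unfolding arr_sim_def using u by metis
qed

lemma tupling_Id_mem:
  assumes "A \<in> Obj C" "tupling C (Id C A) M" "f \<in># M"
  shows "f \<in> Arr C" "Dom C f = A"
  using tupling_mem[OF assms(2,3)] assms(1) by (auto simp: Id_in_Arr)

lemma tupling_self: "f \<in> Arr C \<Longrightarrow> tupling C f {#f#}"
  by (simp add: tupling_single arr_sim_refl)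

lemma decomp_eqI:
  assumes "arr_sim C f f'" "arr_sim C g g'" "f \<in> Arr C" "g \<in> Arr C"
  shows "decomp C A [f, g] = decomp C A [f', g']"
proof -
  have *: "arr_sim C f' f" "arr_sim C g' g" "f' \<in> Arr C" "g' \<in> Arr C"
    using assms arr_sim_sym arr_sim_Arr(1) by blast+
  have "diagram_approx C [f, g] gs \<longleftrightarrow> diagram_approx C [f', g'] gs" for gs
    using arr_sim_trans[OF assms(1) _ assms(3)] arr_sim_trans[OF assms(2) _ assms(4)]
      arr_sim_trans[OF *(1) _ *(3)] arr_sim_trans[OF *(2) _ *(4)]
    by (auto simp: diagram_approx_def list_all2_Cons1)
  then show ?thesis by (simp add: decomp_def)
qed

lemma decomp_eqD:
  assumes A: "A \<in> Obj C" and fg: "tupling C (Id C A) {#f, g#}" and f'g': "tupling C (Id C A) {#f', g'#}"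
    and eq: "decomp C A [f, g] = decomp C A [f', g']"
  shows "arr_sim C f f'" "arr_sim C g g'"
proof -
  note mem = tupling_Id_mem[OF A fg] tupling_Id_mem[OF A f'g']
  have "[f', g'] \<in> decomp C A [f', g']"
    using f'g' mem product_diagram_iff_tupling[OF A, of "[f', g']"]
    by (auto simp: decomp_def diagram_approx_def arr_sim_refl)
  then show "arr_sim C f f'" "arr_sim C g g'"
    unfolding eq[symmetric] by (auto simp: decomp_def diagram_approx_def)
qed

lemma decomps_2_iff:
  assumes "A \<in> Obj C"
  shows "x \<in> decomps C 2 A \<longleftrightarrow> (\<exists>f g. tupling C (Id C A) {#f, g#} \<and> x = decomp C A [f, g])"
proof -
  have "product_diagram C A [f, g] \<longleftrightarrow> tupling C (Id C A) {#f, g#}" for f g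
    using product_diagram_iff_tupling[OF assms, of "[f, g]"] by simp
  then show ?thesis
    by (auto simp: decomps_def numeral_2_eq_2 length_Suc_conv)
qed

end

context strongly_honest_category begin

lemma component_epi:
  assumes "A \<in> Obj C" "tupling C (Id C A) M" "f \<in># M"
  shows "is_epi C f"
proof -
  obtain fs where fs: "mset fs = M" by (metis ex_mset)
  then have "product_diagram C A fs" using product_diagram_iff_tupling assms by simp
  then show ?thesis using honest assms(3) fs by (auto simp: strongly_honest_def)
qed

text \<open>The pushout condition as a statement about the factorization preorder: \<open>f3\<close> is a greatest lower
bound of the pairings \<open>s\<close> and \<open>t\<close>. A morphism \<open>x\<close> that factors through both is a cocone under the
span of the pushout square, whose diagonal is \<open>f3\<close>. Stated with tuplings, the condition holds for
any choice of the two products.\<close>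

lemma common_factor:
  assumes A: "A \<in> Obj C" and f: "tupling C (Id C A) {#f1, f2, f3#}"
    and s: "tupling C s {#f1, f3#}" and t: "tupling C t {#f2, f3#}"
    and xs: "factors C x s" and xt: "factors C x t"
  shows "factors C x f3"
proof -
  have mem: "f1 \<in> Arr C" "f2 \<in> Arr C" "f3 \<in> Arr C" "Dom C f1 = A" "Dom C f2 = A" "Dom C f3 = A"
    using tupling_Id_mem[OF A f] by auto
  define s0 t0 p q where defs: "s0 = tuple C A [f1, f3]" "t0 = tuple C A [f2, f3]"
    "p = projs C [Cod C f1, Cod C f3] ! 1" "q = projs C [Cod C f2, Cod C f3] ! 1"
  have "product_diagram C A [f1, f2, f3]" using f product_diagram_iff_tupling[OF A] by simp
  then have po: "is_pushout C s0 t0 p q" using honest by (simp add: strongly_honest_def defs)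
  note s0 = tuple[of A "[f1, f3]", folded defs] and t0 = tuple[of A "[f2, f3]", folded defs]
  have src: "source C A [f1, f3]" "source C A [f2, f3]" using mem A by (auto simp: source_def)
  have "arr_sim C s0 s" "arr_sim C t0 t"
    using tupling_unique[of s0 "{#f1, f3#}" s] tupling_unique[of t0 "{#f2, f3#}" t]
      s0[OF src(1)] t0[OF src(2)] s t tupling_mem(2)[OF s, of f1] tupling_mem(2)[OF t, of f2] mem
    by auto
  then have "factors C x s0" "factors C x t0"
    using factors_sim factors_trans xs xt s0(1)[OF src(1)] t0(1)[OF src(2)] by blast+
  then obtain a b where ab: "in_hom C a (Cod C s0) (Cod C x)" "x = a \<circ>\<^sub>C s0"
    "in_hom C b (Cod C t0) (Cod C x)" "x = b \<circ>\<^sub>C t0"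
    unfolding factors_def by blast
  then obtain u where u: "in_hom C u (Cod C p) (Cod C x)" "u \<circ>\<^sub>C p = a"
    using po unfolding is_pushout_def by metis
  have p: "p \<in> Arr C" "Dom C p = Cod C s0" using po by (auto simp: is_pushout_def)
  have "map (\<lambda>r. r \<circ>\<^sub>C s0) (projs C [Cod C f1, Cod C f3]) = [f1, f3]" using s0(4)[OF src(1)] by simp
  then have ps: "p \<circ>\<^sub>C s0 = f3" by (auto simp: defs map_eq_Cons_conv)
  then have "Cod C p = Cod C f3" "x = u \<circ>\<^sub>C f3"
    using p u ab(2) s0(1)[OF src(1)] assoc[of s0 p u] comp_in_Arr[of s0 p] by (auto simp: in_hom_def)
  then show ?thesis using u by (auto simp: factors_def)
qed

text \<open>Each of \<open>c3\<close> and \<open>d3\<close> factors through both \<open>s\<close> and \<open>t\<close>, hence through the other one.\<close>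

lemma third_component_unique:
  assumes A: "A \<in> Obj C"
    and c: "tupling C (Id C A) {#c1, c2, c3#}" and d: "tupling C (Id C A) {#d1, d2, d3#}"
    and sc: "tupling C s {#c1, c3#}" and sd: "tupling C s {#d1, d3#}"
    and tc: "tupling C t {#c2, c3#}" and td: "tupling C t {#d2, d3#}"
  shows "arr_sim C c3 d3"
proof (rule factors_antisym)
  show "is_epi C c3" using component_epi[OF A c] by simp
  show "is_epi C d3" using component_epi[OF A d] by simp
  show "factors C c3 d3"
    using common_factor[OF A d sd td] tupling_factors[OF sc] tupling_factors[OF tc] by simp
  show "factors C d3 c3"
    using common_factor[OF A c sc tc] tupling_factors[OF sd] tupling_factors[OF td] by simp
qed

lemma tupling_add_tau:
  assumes "tupling C t M" "Dom C t = A" "A \<in> Obj C"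
  shows "tupling C t (add_mset (tau C A) M)"
  using tupling_gather[OF assms(1) tau(4)[OF assms(3)], of M] tau(2)[OF assms(3)] assms(2) by simp

lemma tupling_Id_tau:
  assumes "A \<in> Obj C"
  shows "tupling C (Id C A) {#Id C A, tau C A#}"
  using tupling_add_tau[OF tupling_self[of "Id C A"]] assms by (simp add: Id_in_Arr add_mset_commute)

text \<open>In the ternary product diagram \<open>(1, f, \<tau>)\<close> the pairings with \<open>\<tau>\<close> are \<open>1\<close> and \<open>f\<close> themselves; as \<open>f\<close>
factors through both, it factors through \<open>\<tau>\<close>.\<close>

lemma complement_of_Id:
  assumes A: "A \<in> Obj C" and f: "tupling C (Id C A) {#Id C A, f#}"
  shows "arr_sim C f (tau C A)"
proof (rule factors_antisym)
  have fA: "f \<in> Arr C" "Dom C f = A" using tupling_Id_mem[OF A f] by auto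
  have 3: "tupling C (Id C A) {#Id C A, f, tau C A#}"
    using tupling_add_tau[OF f] A by (simp add: Id_in_Arr add_mset_commute)
  have I: "tupling C (Id C A) {#Id C A, tau C A#}"
    by (rule tupling_Id_tau[OF A])
  have F: "tupling C f {#f, tau C A#}"
    using tupling_add_tau[OF tupling_self[of f]] A fA by (simp add: add_mset_commute)
  show "is_epi C f" "is_epi C (tau C A)" using component_epi[OF A 3] by auto
  show "factors C f (tau C A)"
    using common_factor[OF A 3 I F, of f] tupling_factors[OF f] factors_refl[OF fA(1)] by simp
  show "factors C (tau C A) f" using tupling_factors[OF F] by simp
qed

section \<open>Binary decompositions form an orthoalgebra\<close>

text \<open>Sums of decompositions may be witnessed with arbitrary pairings instead of the chosen ones.\<close>

lemma decomp_sumI: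
  assumes A: "A \<in> Obj C" and c: "tupling C (Id C A) {#c1, c2, c3#}"
    and a: "tupling C a {#c2, c3#}" and b: "tupling C b {#c1, c3#}" and e: "tupling C e {#c1, c2#}"
  shows "decomp_sum C A (decomp C A [c1, a]) (decomp C A [c2, b]) (decomp C A [e, c3])"
proof -
  have mem: "c1 \<in> Arr C" "c2 \<in> Arr C" "c3 \<in> Arr C" "Dom C c1 = A" "Dom C c2 = A" "Dom C c3 = A"
    using tupling_Id_mem[OF A c] by auto
  have dom: "Dom C a = A" "Dom C b = A" "Dom C e = A"
    using tupling_mem(2)[OF a, of c2] tupling_mem(2)[OF b, of c1] tupling_mem(2)[OF e, of c1] mem by auto
  note arr = tupling_Arr[OF a] tupling_Arr[OF b] tupling_Arr[OF e]
  have src: "source C A [c2, c3]" "source C A [c1, c3]" "source C A [c1, c2]"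
    using mem A by (auto simp: source_def)
  have "arr_sim C a (tuple C A [c2, c3])" "arr_sim C b (tuple C A [c1, c3])"
    "arr_sim C e (tuple C A [c1, c2])"
    using tupling_unique[OF a] tupling_unique[OF b] tupling_unique[OF e]
      tuple[OF src(1)] tuple[OF src(2)] tuple[OF src(3)] dom by auto
  then have "decomp C A [c1, a] = decomp C A [c1, tuple C A [c2, c3]]"
    "decomp C A [c2, b] = decomp C A [c2, tuple C A [c1, c3]]"
    "decomp C A [e, c3] = decomp C A [tuple C A [c1, c2], c3]"
    using mem arr by - (rule decomp_eqI; (assumption | rule arr_sim_refl, assumption))+
  moreover have "product_diagram C A [c1, c2, c3]" using c product_diagram_iff_tupling[OF A] by simp
  ultimately show ?thesis unfolding decomp_sum_def by blast
qed

lemma decomp_sumE: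
  assumes A: "A \<in> Obj C" and sum: "decomp_sum C A x y z"
  obtains c1 c2 c3 a b e where "tupling C (Id C A) {#c1, c2, c3#}"
    "c1 \<in> Arr C" "c2 \<in> Arr C" "c3 \<in> Arr C" "Dom C c1 = A" "Dom C c2 = A" "Dom C c3 = A"
    "tupling C a {#c2, c3#}" "tupling C b {#c1, c3#}" "tupling C e {#c1, c2#}"
    "a \<in> Arr C" "b \<in> Arr C" "e \<in> Arr C" "Dom C a = A" "Dom C b = A" "Dom C e = A"
    "x = decomp C A [c1, a]" "y = decomp C A [c2, b]" "z = decomp C A [e, c3]"
    "tupling C (Id C A) {#c1, a#}" "tupling C (Id C A) {#c2, b#}" "tupling C (Id C A) {#e, c3#}"
proof -
  obtain c1 c2 c3 where c': "product_diagram C A [c1, c2, c3]"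
    and xyz: "x = decomp C A [c1, tuple C A [c2, c3]]" "y = decomp C A [c2, tuple C A [c1, c3]]"
    "z = decomp C A [tuple C A [c1, c2], c3]"
    using sum by (auto simp: decomp_sum_def)
  have c: "tupling C (Id C A) {#c1, c2, c3#}" using c' product_diagram_iff_tupling[OF A] by simp
  have mem: "c1 \<in> Arr C" "c2 \<in> Arr C" "c3 \<in> Arr C" "Dom C c1 = A" "Dom C c2 = A" "Dom C c3 = A"
    using tupling_Id_mem[OF A c] by auto
  have src: "source C A [c2, c3]" "source C A [c1, c3]" "source C A [c1, c2]"
    using mem A by (auto simp: source_def)
  note t = tuple(1,2,5)[OF src(1)] tuple(1,2,5)[OF src(2)] tuple(1,2,5)[OF src(3)]
  have "tupling C (Id C A) {#c1, tuple C A [c2, c3]#}" "tupling C (Id C A) {#c2, tuple C A [c1, c3]#}"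
    "tupling C (Id C A) {#tuple C A [c1, c2], c3#}"
    using tupling_gather[OF c t(3), of "{#c1#}"] tupling_gather[OF c t(6), of "{#c2#}"]
      tupling_gather[OF c t(9), of "{#c3#}"] t A by (simp_all add: Id_in_Arr add_mset_commute)
  with that[OF c mem] t xyz show thesis by simp
qed

text \<open>The classes \<open>x\<close> and \<open>y\<close> fix the first two components of the witness up to \<open>\<simeq>\<close> and the two pairings
with the third one, so \<open>third_component_unique\<close> applies.\<close>

lemma decomp_sum_unique:
  assumes A: "A \<in> Obj C" and z: "decomp_sum C A x y z" and z': "decomp_sum C A x y z'"
  shows "z = z'"
proof -
  from A z obtain c1 c2 c3 a b e where c: "tupling C (Id C A) {#c1, c2, c3#}"
    and c_arr: "c1 \<in> Arr C" "c2 \<in> Arr C" "c3 \<in> Arr C"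
    and cc: "tupling C a {#c2, c3#}" "tupling C b {#c1, c3#}" "tupling C e {#c1, c2#}"
    and ce: "e \<in> Arr C" "Dom C e = A"
    and cx: "x = decomp C A [c1, a]" "y = decomp C A [c2, b]" "z = decomp C A [e, c3]"
    and cp: "tupling C (Id C A) {#c1, a#}" "tupling C (Id C A) {#c2, b#}"
    by (rule decomp_sumE)
  from A z' obtain d1 d2 d3 a' b' e' where d: "tupling C (Id C A) {#d1, d2, d3#}"
    and d_arr: "d1 \<in> Arr C" "d2 \<in> Arr C" "d3 \<in> Arr C"
    and dd: "tupling C a' {#d2, d3#}" "tupling C b' {#d1, d3#}" "tupling C e' {#d1, d2#}"
    and de: "a' \<in> Arr C" "b' \<in> Arr C" "e' \<in> Arr C" "Dom C e' = A"
    and dx: "x = decomp C A [d1, a']" "y = decomp C A [d2, b']" "z' = decomp C A [e', d3]"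
    and dp: "tupling C (Id C A) {#d1, a'#}" "tupling C (Id C A) {#d2, b'#}"
    by (rule decomp_sumE)
  have sim: "arr_sim C d1 c1" "arr_sim C a' a" "arr_sim C d2 c2" "arr_sim C b' b"
    using decomp_eqD[OF A dp(1) cp(1)] decomp_eqD[OF A dp(2) cp(2)] cx dx by auto
  have "arr_sim C c3 d3"
    using third_component_unique[OF A c d cc(2) _ cc(1)] tupling_sim[OF dd(2) sim(4)] tupling_sim[OF dd(1) sim(2)]
    by blast
  moreover have "tupling C e' {#c1, c2#}"
    using tupling_replace[OF dd(3) sim(1)] tupling_replace[of e' d2 "{#c1#}" c2] sim(3)
    by (simp add: add_mset_commute)
  then have "arr_sim C e e'" using tupling_unique[OF cc(3)] ce de by simp
  ultimately show ?thesis unfolding cx dx using c_arr ce by (intro decomp_eqI)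
qed

lemma DA_plus_iff:
  assumes "A \<in> Obj C"
  shows "oa_plus (DA C A) x y = Some z \<longleftrightarrow> decomp_sum C A x y z"
proof -
  have "(THE z. decomp_sum C A x y z) = z" if "decomp_sum C A x y z" for z
    using that by (rule the_equality) (rule decomp_sum_unique[OF assms _ that])
  then show ?thesis by (auto simp: DA_def)
qed

lemma decomp_sum_closed:
  assumes A: "A \<in> Obj C" and sum: "decomp_sum C A x y z"
  shows "x \<in> decomps C 2 A" "y \<in> decomps C 2 A" "z \<in> decomps C 2 A"
proof -
  from A sum obtain c1 c2 c3 a b e where
    "x = decomp C A [c1, a]" "y = decomp C A [c2, b]" "z = decomp C A [e, c3]"
    "tupling C (Id C A) {#c1, a#}" "tupling C (Id C A) {#c2, b#}" "tupling C (Id C A) {#e, c3#}"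
    by (rule decomp_sumE)
  then show "x \<in> decomps C 2 A" "y \<in> decomps C 2 A" "z \<in> decomps C 2 A"
    unfolding decomps_2_iff[OF A] by blast+
qed

lemma decomp_sum_commute:
  assumes A: "A \<in> Obj C" and sum: "decomp_sum C A x y z"
  shows "decomp_sum C A y x z"
proof -
  from A sum obtain c1 c2 c3 a b e where c: "tupling C (Id C A) {#c1, c2, c3#}"
    and cc: "tupling C a {#c2, c3#}" "tupling C b {#c1, c3#}" "tupling C e {#c1, c2#}"
    and cx: "x = decomp C A [c1, a]" "y = decomp C A [c2, b]" "z = decomp C A [e, c3]"
    by (rule decomp_sumE)
  show ?thesis unfolding cx
    using decomp_sumI[OF A _ cc(2,1), of e] c cc(3) by (simp add: add_mset_commute)
qed

text \<open>The ternary diagrams for \<open>x \<oplus> y\<close> and \<open>(x \<oplus> y) \<oplus> z\<close> share the factor \<open>(c1, c2) \<simeq> d1\<close>. Splitting it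
gives the quaternary diagram \<open>(c1, c2, d2, d3)\<close>, whose other groupings witness the sums on the
right-hand side of the associative law.\<close>

lemma decomp_sum_assoc:
  assumes A: "A \<in> Obj C" and u: "decomp_sum C A x y u" and w: "decomp_sum C A u z w"
  obtains v where "decomp_sum C A y z v" "decomp_sum C A x v w"
proof -
  from A u obtain c1 c2 c3 a b e where c: "tupling C (Id C A) {#c1, c2, c3#}"
    and c_arr: "c1 \<in> Arr C" "c2 \<in> Arr C" "Dom C c1 = A" "Dom C c2 = A"
    and cc: "tupling C a {#c2, c3#}" "tupling C b {#c1, c3#}" "tupling C e {#c1, c2#}"
    and cd: "Dom C a = A" "Dom C b = A"
    and cx: "x = decomp C A [c1, a]" "y = decomp C A [c2, b]" "u = decomp C A [e, c3]"
    and cp: "tupling C (Id C A) {#e, c3#}"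
    by (rule decomp_sumE)
  from A w obtain d1 d2 d3 a' b' e' where d: "tupling C (Id C A) {#d1, d2, d3#}"
    and d_arr: "d2 \<in> Arr C" "d3 \<in> Arr C" "Dom C d2 = A" "Dom C d3 = A"
    and dd: "tupling C a' {#d2, d3#}" "tupling C b' {#d1, d3#}" "tupling C e' {#d1, d2#}"
    and de: "a' \<in> Arr C" "Dom C b' = A" "Dom C e' = A"
    and dx: "u = decomp C A [d1, a']" "z = decomp C A [d2, b']" "w = decomp C A [e', d3]"
    and dp: "tupling C (Id C A) {#d1, a'#}"
    by (rule decomp_sumE)
  have sim: "arr_sim C e d1" "arr_sim C a' c3"
    using decomp_eqD[OF A cp dp] decomp_eqD[OF A dp cp] cx dx by auto
  have d1: "tupling C d1 {#c1, c2#}" using tupling_sim[OF cc(3) sim(1)] .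
  have c3: "tupling C c3 {#d2, d3#}" using tupling_sim[OF dd(1) sim(2)] .
  \<comment> \<open>\<open>v1\<close> and \<open>v2\<close> pair the factors of \<open>y \<oplus> z\<close> and of its complement.\<close>
  obtain v1 where v1: "tupling C v1 {#c2, d2#}" "Dom C v1 = A" using pairing_exists c_arr d_arr by blast
  obtain v2 where v2: "tupling C v2 {#c1, d3#}" "Dom C v2 = A" using pairing_exists c_arr d_arr by blast
  have 4: "tupling C (Id C A) {#c1, c2, d2, d3#}"
    using tupling_expand[OF d d1, of "{#d2, d3#}"] by (simp add: add_mset_commute)
  have "tupling C b {#c1, d2, d3#}" using tupling_expand[OF cc(2) c3, of "{#c1#}"] by (simp add: add_mset_commute)
  then have b: "tupling C b {#d2, v2#}"
    using tupling_gather[OF _ v2(1), of b _ "{#d2#}"] v2 cd by (simp add: add_mset_commute)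
  have "tupling C b' {#c1, c2, d3#}" using tupling_expand[OF dd(2) d1, of "{#d3#}"] by (simp add: add_mset_commute)
  then have b': "tupling C b' {#c2, v2#}"
    using tupling_gather[OF _ v2(1), of b' _ "{#c2#}"] v2 de by (simp add: add_mset_commute)
  have I2: "tupling C (Id C A) {#c2, d2, v2#}"
    using tupling_gather[OF 4 v2(1), of "{#c2, d2#}"] v2 A by (simp add: add_mset_commute Id_in_Arr)
  have s1: "decomp_sum C A y z (decomp C A [v1, v2])"
    unfolding cx dx by (rule decomp_sumI[OF A I2 b b' v1(1)])
  have "tupling C a {#c2, d2, d3#}" using tupling_expand[OF cc(1) c3, of "{#c2#}"] by (simp add: add_mset_commute)
  then have a: "tupling C a {#v1, d3#}"
    using tupling_gather[OF _ v1(1), of a _ "{#d3#}"] v1 cd by (simp add: add_mset_commute)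
  have "tupling C e' {#c1, c2, d2#}" using tupling_expand[OF dd(3) d1, of "{#d2#}"] by (simp add: add_mset_commute)
  then have e': "tupling C e' {#c1, v1#}"
    using tupling_gather[OF _ v1(1), of e' _ "{#c1#}"] v1 de by (simp add: add_mset_commute)
  have I1: "tupling C (Id C A) {#c1, v1, d3#}"
    using tupling_gather[OF 4 v1(1), of "{#c1, d3#}"] v1 A by (simp add: add_mset_commute Id_in_Arr)
  have "decomp_sum C A x (decomp C A [v1, v2]) w"
    unfolding cx dx by (rule decomp_sumI[OF A I1 a v2(1) e'])
  with s1 that show thesis by blast
qed

text \<open>If \<open>[(c1, c2), c3] = [1, \<tau>]\<close> then \<open>c3\<close> is a morphism to a terminal object and can be dropped: the two
summands are \<open>[c1, c2]\<close> and \<open>[c2, c1]\<close>.\<close>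

lemma decomp_sum_one_iff:
  assumes A: "A \<in> Obj C" and f: "tupling C (Id C A) {#f1, f2#}"
  shows "decomp_sum C A (decomp C A [f1, f2]) y (decomp C A [Id C A, tau C A]) \<longleftrightarrow>
    y = decomp C A [f2, f1]"
proof
  have mem: "f1 \<in> Arr C" "f2 \<in> Arr C" "Dom C f1 = A" "Dom C f2 = A" using tupling_Id_mem[OF A f] by auto
  have 3: "tupling C (Id C A) {#f1, f2, tau C A#}"
    using tupling_add_tau[OF f] A by (simp add: Id_in_Arr add_mset_commute)
  have "tupling C f1 {#f1, tau C A#}" "tupling C f2 {#f2, tau C A#}"
    using tupling_add_tau[OF tupling_self[of f1]] tupling_add_tau[OF tupling_self[of f2]] A mem
    by (simp_all add: add_mset_commute)
  then show "decomp_sum C A (decomp C A [f1, f2]) y (decomp C A [Id C A, tau C A])"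
    if "y = decomp C A [f2, f1]"
    unfolding that using decomp_sumI[OF A 3] f by blast
  assume "decomp_sum C A (decomp C A [f1, f2]) y (decomp C A [Id C A, tau C A])"
  with A obtain c1 c2 c3 a b e where c: "tupling C (Id C A) {#c1, c2, c3#}"
    and c_arr: "c1 \<in> Arr C" "c2 \<in> Arr C" "c3 \<in> Arr C"
    and cc: "tupling C a {#c2, c3#}" "tupling C b {#c1, c3#}" "tupling C e {#c1, c2#}"
    and cd: "a \<in> Arr C" "b \<in> Arr C"
    and cx: "decomp C A [f1, f2] = decomp C A [c1, a]" "y = decomp C A [c2, b]"
      "decomp C A [Id C A, tau C A] = decomp C A [e, c3]"
    and cp: "tupling C (Id C A) {#c1, a#}" "tupling C (Id C A) {#e, c3#}"
    by (rule decomp_sumE)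
  have "tupling C (Id C A) {#Id C A, tau C A#}"
    by (rule tupling_Id_tau[OF A])
  then have "arr_sim C (tau C A) c3" using decomp_eqD(2)[OF A _ cp(2)] cx(3) by blast
  then have c3: "tupling C c3 {#}" using tupling_sim[OF tau(4)[OF A]] by blast
  have "tupling C a {#c2#}" "tupling C b {#c1#}"
    using tupling_expand[OF cc(1) c3, of "{#c2#}"] tupling_expand[OF cc(2) c3, of "{#c1#}"]
    by (simp_all add: add_mset_commute)
  then have ab: "arr_sim C a c2" "arr_sim C b c1" using tupling_single cd c_arr by auto
  have "arr_sim C f1 c1" "arr_sim C f2 a" using decomp_eqD[OF A f cp(1) cx(1)] .
  then have "arr_sim C f2 c2" "arr_sim C f1 b"
    using ab arr_sim_trans arr_sim_sym mem cd by blast+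
  then show "y = decomp C A [f2, f1]" unfolding cx using decomp_eqI[of f2 c2 f1 b A] mem by simp
qed

text \<open>Here the pairings \<open>b = (c1, c3)\<close> and \<open>a = (c2, c3)\<close> agree up to \<open>\<simeq>\<close>, so their meet \<open>c3\<close> agrees with
\<open>b\<close>. The product diagram \<open>(c2, b)\<close> is then \<open>(c2, c3)\<close>, so that \<open>a \<simeq> 1\<close>, and its complement \<open>c1\<close> is
\<open>\<tau>\<close>.\<close>

lemma decomp_sum_self:
  assumes A: "A \<in> Obj C" and sum: "decomp_sum C A x x z"
  shows "x = decomp C A [tau C A, Id C A]"
proof -
  from A sum obtain c1 c2 c3 a b e where c: "tupling C (Id C A) {#c1, c2, c3#}"
    and c_arr: "c1 \<in> Arr C" "c2 \<in> Arr C" "c3 \<in> Arr C"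
    and cc: "tupling C a {#c2, c3#}" "tupling C b {#c1, c3#}" "tupling C e {#c1, c2#}"
    and cd: "a \<in> Arr C" "b \<in> Arr C" "Dom C a = A" "Dom C b = A"
    and cx: "x = decomp C A [c1, a]" "x = decomp C A [c2, b]"
    and cp: "tupling C (Id C A) {#c1, a#}" "tupling C (Id C A) {#c2, b#}"
    by (rule decomp_sumE)
  have ab: "arr_sim C a b" "arr_sim C b a"
    using decomp_eqD(2)[OF A cp] decomp_eqD(2)[OF A cp(2,1)] cx by auto
  have "factors C b a" using factors_sim ab by blast
  then have "factors C b c3" using common_factor[OF A c cc(2,1)] factors_refl cd by blast
  moreover have "factors C c3 b" using tupling_factors[OF cc(2)] by simp
  ultimately have "arr_sim C b c3"
    using component_epi[OF A c] component_epi[OF A cp(2)] by (intro factors_antisym) auto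
  then have "tupling C (Id C A) {#c2, c3#}"
    using tupling_replace[of "Id C A" b "{#c2#}" c3] cp(2) by (simp add: add_mset_commute)
  then have "arr_sim C a (Id C A)" using tupling_unique[OF cc(1)] cd A by (simp add: Id_in_Arr)
  moreover from this have "tupling C (Id C A) {#Id C A, c1#}"
    using tupling_replace[of "Id C A" a "{#c1#}" "Id C A"] cp(1) by (simp add: add_mset_commute)
  then have "arr_sim C c1 (tau C A)" by (rule complement_of_Id[OF A])
  ultimately show ?thesis unfolding cx(1) using c_arr cd by (intro decomp_eqI)
qed

theorem orthoalgebra_DA:
  assumes A: "A \<in> Obj C"
  shows "orthoalgebra (DA C A)"
proof -
  note plus = DA_plus_iff[OF A]
  have carrier: "oa_carrier (DA C A) = decomps C 2 A" and zero: "oa_zero (DA C A) = decomp C A [tau C A, Id C A]"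
    and one: "oa_one (DA C A) = decomp C A [Id C A, tau C A]" by (simp_all add: DA_def)
  have I: "tupling C (Id C A) {#Id C A, tau C A#}"
    by (rule tupling_Id_tau[OF A])
  have comm: "oa_plus (DA C A) x y = oa_plus (DA C A) y x" for x y
  proof -
    have "oa_plus (DA C A) x y = Some z \<longleftrightarrow> oa_plus (DA C A) y x = Some z" for z
      unfolding plus using decomp_sum_commute[OF A] by blast
    then show ?thesis by (metis not_Some_eq)
  qed
  \<comment> \<open>One direction of associativity suffices, as reversing the summands gives the other.\<close>
  have le: "Option.bind (oa_plus (DA C A) y z) (\<lambda>v. oa_plus (DA C A) x v) = Some w"
    if "Option.bind (oa_plus (DA C A) x y) (\<lambda>u. oa_plus (DA C A) u z) = Some w" for x y z w
  proof -
    from that obtain u where "decomp_sum C A x y u" "decomp_sum C A u z w"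
      by (auto simp: bind_eq_Some_conv plus)
    then obtain v where "decomp_sum C A y z v" "decomp_sum C A x v w"
      by (rule decomp_sum_assoc[OF A])
    then show ?thesis by (auto simp: bind_eq_Some_conv plus)
  qed
  have assoc_eq: "Option.bind (oa_plus (DA C A) x y) (\<lambda>u. oa_plus (DA C A) u z) = Some w \<longleftrightarrow>
    Option.bind (oa_plus (DA C A) y z) (\<lambda>v. oa_plus (DA C A) x v) = Some w" for x y z w
    using le[of x y z w] le[of z y x w] by (auto simp: comm)
  show ?thesis
  proof (unfold_locales, unfold carrier zero one)
    show "decomp C A [tau C A, Id C A] \<in> decomps C 2 A" "decomp C A [Id C A, tau C A] \<in> decomps C 2 A"
      using I I[unfolded add_mset_commute[of "Id C A"]] decomps_2_iff[OF A] by blast+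
    show "z \<in> decomps C 2 A" if "oa_plus (DA C A) x y = Some z" for x y z
      using that decomp_sum_closed[OF A] plus by blast
    show "oa_plus (DA C A) x y = oa_plus (DA C A) y x" for x y by (rule comm)
    show "Option.bind (oa_plus (DA C A) x y) (\<lambda>u. oa_plus (DA C A) u z) =
      Option.bind (oa_plus (DA C A) y z) (\<lambda>v. oa_plus (DA C A) x v)" for x y z
      using assoc_eq by (metis not_Some_eq)
    show "\<exists>!y. y \<in> decomps C 2 A \<and> oa_plus (DA C A) x y = Some (decomp C A [Id C A, tau C A])"
      if "x \<in> decomps C 2 A" for x
    proof -
      from that obtain f1 f2 where f: "tupling C (Id C A) {#f1, f2#}" "x = decomp C A [f1, f2]"
        using decomps_2_iff[OF A] by auto
      have "decomp C A [f2, f1] \<in> decomps C 2 A" using f(1)[unfolded add_mset_commute[of f1]] decomps_2_iff[OF A] by blast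
      then show ?thesis unfolding plus f(2) decomp_sum_one_iff[OF A f(1)] by blast
    qed
    show "x = decomp C A [tau C A, Id C A]" if "oa_plus (DA C A) x x \<noteq> None" for x
      using that plus decomp_sum_self[OF A] by auto
  qed
qed

end

section \<open>Transport of orthoalgebra structure\<close>

text \<open>The hypothesis on sums includes that \<open>\<psi>\<close> reflects definedness, which makes it possible to carry
the axioms, and not only the sums, over to \<open>L\<close>.\<close>

lemma orthoalgebra_transport:
  assumes M: "orthoalgebra M" and bij: "bij_betw \<psi> (oa_carrier M) (oa_carrier L)"
    and zero: "\<psi> (oa_zero M) = oa_zero L" and one: "\<psi> (oa_one M) = oa_one L"
    and plus: "\<And>x y. x \<in> oa_carrier M \<Longrightarrow> y \<in> oa_carrier M \<Longrightarrow>
      oa_plus L (\<psi> x) (\<psi> y) = map_option \<psi> (oa_plus M x y)"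
  shows "oa_isomorphic L M"
proof -
  interpret M: orthoalgebra M by (rule M)
  have ran: "\<exists>x \<in> oa_carrier M. x' = \<psi> x" if "x' \<in> oa_carrier L" for x'
    using that bij by (auto simp: bij_betw_def)
  have dom: "\<psi> x \<in> oa_carrier L" if "x \<in> oa_carrier M" for x
    using that bij by (auto simp: bij_betw_def)
  have inj: "\<psi> x = \<psi> y \<longleftrightarrow> x = y" if "x \<in> oa_carrier M" "y \<in> oa_carrier M" for x y
    using inj_on_eq_iff[OF bij_betw_imp_inj_on[OF bij] that] .
  have plus_SomeE: "\<exists>z \<in> oa_carrier M. z' = \<psi> z \<and> oa_plus M x y = Some z"
    if s: "oa_plus L (\<psi> x) (\<psi> y) = Some z'" and x: "x \<in> oa_carrier M" and y: "y \<in> oa_carrier M" for x y z'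
  proof -
    obtain z where "oa_plus M x y = Some z" "z' = \<psi> z"
      using s unfolding plus[OF x y] by auto
    then show ?thesis using M.plus_closed[OF x y] by blast
  qed
  have "orthoalgebra L"
  proof
    show "oa_zero L \<in> oa_carrier L" "oa_one L \<in> oa_carrier L"
      using dom[OF M.zero_closed] dom[OF M.one_closed] zero one by auto
    show "z' \<in> oa_carrier L" if xy: "x' \<in> oa_carrier L" "y' \<in> oa_carrier L" and s: "oa_plus L x' y' = Some z'" for x' y' z'
    proof -
      obtain x y where x: "x \<in> oa_carrier M" "x' = \<psi> x" and y: "y \<in> oa_carrier M" "y' = \<psi> y"
        using xy[THEN ran] by blast
      show ?thesis using plus_SomeE[OF s[unfolded x(2) y(2)] x(1) y(1)] dom by blast
    qed
    show "oa_plus L x' y' = oa_plus L y' x'" if xy: "x' \<in> oa_carrier L" "y' \<in> oa_carrier L" for x' y'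
    proof -
      obtain x y where "x \<in> oa_carrier M" "x' = \<psi> x" "y \<in> oa_carrier M" "y' = \<psi> y"
        using xy[THEN ran] by blast
      then show ?thesis using M.plus_commute[of x y] by (simp add: plus)
    qed
    show "Option.bind (oa_plus L x' y') (\<lambda>u. oa_plus L u z') = Option.bind (oa_plus L y' z') (oa_plus L x')"
      if xyz: "x' \<in> oa_carrier L" "y' \<in> oa_carrier L" "z' \<in> oa_carrier L" for x' y' z'
    proof -
      obtain x y z where x: "x \<in> oa_carrier M" "x' = \<psi> x" and y: "y \<in> oa_carrier M" "y' = \<psi> y"
        and z: "z \<in> oa_carrier M" "z' = \<psi> z" using xyz[THEN ran] by blast
      have "Option.bind (oa_plus L x' y') (\<lambda>u. oa_plus L u z') =
          map_option \<psi> (Option.bind (oa_plus M x y) (\<lambda>u. oa_plus M u z))"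
        using M.plus_closed[OF x(1) y(1)] by (cases "oa_plus M x y") (simp_all add: x y z plus)
      also have "\<dots> = map_option \<psi> (Option.bind (oa_plus M y z) (oa_plus M x))"
        by (simp only: M.plus_assoc[OF x(1) y(1) z(1)])
      also have "\<dots> = Option.bind (oa_plus L y' z') (oa_plus L x')"
        using M.plus_closed[OF y(1) z(1)] by (cases "oa_plus M y z") (simp_all add: x y z plus)
      finally show ?thesis .
    qed
    show "\<exists>!y'. y' \<in> oa_carrier L \<and> oa_plus L x' y' = Some (oa_one L)" if "x' \<in> oa_carrier L" for x'
    proof -
      obtain x where x: "x \<in> oa_carrier M" "x' = \<psi> x" using ran \<open>x' \<in> oa_carrier L\<close> by blast
      have iff: "oa_plus L (\<psi> x) (\<psi> y) = Some (oa_one L) \<longleftrightarrow> oa_plus M x y = Some (oa_one M)"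
        if "y \<in> oa_carrier M" for y
      proof (cases "oa_plus M x y")
        case None then show ?thesis by (simp add: plus[OF x(1) that])
      next
        case (Some z)
        then show ?thesis
          using inj[OF M.plus_closed[OF x(1) that Some] M.one_closed] by (simp add: plus[OF x(1) that] one)
      qed
      obtain y where y: "y \<in> oa_carrier M" "oa_plus M x y = Some (oa_one M)"
        and uniq: "\<And>v. v \<in> oa_carrier M \<Longrightarrow> oa_plus M x v = Some (oa_one M) \<Longrightarrow> v = y"
        using M.orthocomplement[OF x(1)] by blast
      show ?thesis
      proof (rule ex1I[of _ "\<psi> y"])
        show "\<psi> y \<in> oa_carrier L \<and> oa_plus L x' (\<psi> y) = Some (oa_one L)" using y x iff dom by simp
        show "v' = \<psi> y" if v': "v' \<in> oa_carrier L \<and> oa_plus L x' v' = Some (oa_one L)" for v'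
        proof -
          obtain v where "v \<in> oa_carrier M" "v' = \<psi> v" using v' ran by blast
          with v' iff uniq x show ?thesis by simp
        qed
      qed
    qed
    show "x' = oa_zero L" if x': "x' \<in> oa_carrier L" "oa_plus L x' x' \<noteq> None" for x'
    proof -
      obtain x where x: "x \<in> oa_carrier M" "x' = \<psi> x" using x'(1)[THEN ran] by blast
      then have "oa_plus M x x \<noteq> None" using x'(2) plus by auto
      then show ?thesis using M.consistency x zero by simp
    qed
  qed
  moreover have "oa_iso L M (inv_into (oa_carrier M) \<psi>)"
  proof -
    let ?\<phi> = "inv_into (oa_carrier M) \<psi>"
    have \<phi>: "?\<phi> (\<psi> x) = x" if "x \<in> oa_carrier M" for x
      using that bij by (simp add: bij_betw_inv_into_left)
    have b: "bij_betw ?\<phi> (oa_carrier L) (oa_carrier M)" using bij by (rule bij_betw_inv_into)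
    have inv: "inv_into (oa_carrier L) ?\<phi> x = \<psi> x" if "x \<in> oa_carrier M" for x
      using \<phi>[OF that] dom[OF that] b by (metis bij_betw_inv_into_left)
    have "preserves_plus L M ?\<phi>"
      unfolding preserves_plus_def
    proof (intro ballI allI impI)
      fix x' y' z' assume "x' \<in> oa_carrier L" "y' \<in> oa_carrier L" and s: "oa_plus L x' y' = Some z'"
      then obtain x y where x: "x \<in> oa_carrier M" "x' = \<psi> x" and y: "y \<in> oa_carrier M" "y' = \<psi> y"
        using ran by metis
      then obtain z where "z \<in> oa_carrier M" "z' = \<psi> z" "oa_plus M x y = Some z" using plus_SomeE s by metis
      with x y show "oa_plus M (?\<phi> x') (?\<phi> y') = Some (?\<phi> z')" by (simp add: \<phi>)
    qed
    moreover have "preserves_plus M L (inv_into (oa_carrier L) ?\<phi>)"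
      unfolding preserves_plus_def
    proof (intro ballI allI impI)
      fix x y z assume x: "x \<in> oa_carrier M" and y: "y \<in> oa_carrier M" and s: "oa_plus M x y = Some z"
      show "oa_plus L (inv_into (oa_carrier L) ?\<phi> x) (inv_into (oa_carrier L) ?\<phi> y) =
          Some (inv_into (oa_carrier L) ?\<phi> z)"
        by (simp add: inv x y M.plus_closed[OF x y s] plus s)
    qed
    ultimately show ?thesis
      unfolding oa_iso_def using b \<phi>[OF M.zero_closed] \<phi>[OF M.one_closed] zero one by simp
  qed
  ultimately show ?thesis using M by (auto simp: oa_isomorphic_def)
qed

section \<open>Decompositions of a factor and the interval below it\<close>

locale binary_decomposition = strongly_honest_category C
  for C :: "('o, 'm) category" (structure) +
  fixes A H :: 'o and h1 h2 :: 'm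
  assumes A: "A \<in> Obj C" and h: "tupling C (Id C A) {#h1, h2#}" and H: "Cod C h1 = H"
begin

lemma h_Arr: "h1 \<in> Arr C" "h2 \<in> Arr C" "Dom C h1 = A" "Dom C h2 = A"
  using tupling_Id_mem[OF A h] by auto

lemma H_Obj: "H \<in> Obj C"
  using cod_obj[OF h_Arr(1)] H by simp

lemma h1_epi: "is_epi C h1"
  using component_epi[OF A h] by simp

lemma comp_h1:
  assumes "k \<in> Arr C" "Dom C k = H"
  shows "k \<circ>\<^sub>C h1 \<in> Arr C" "Dom C (k \<circ>\<^sub>C h1) = A"
  using assms h_Arr H by (auto simp: comp_in_Arr)

lemma tupling_comp_h1:
  assumes "tupling C t M" "Dom C t = H"
  shows "tupling C (t \<circ>\<^sub>C h1) (image_mset (\<lambda>f. f \<circ>\<^sub>C h1) M)"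
  using tupling_precomp[OF assms(1) h_Arr(1)] assms(2) H by simp

lemma tupling_h1:
  assumes "tupling C (Id C H) M"
  shows "tupling C h1 (image_mset (\<lambda>f. f \<circ>\<^sub>C h1) M)"
  using tupling_comp_h1[OF assms] comp_Id(2)[OF h_Arr(1) H] H_Obj by (simp add: Id_in_Arr)

text \<open>The correspondence \<open>[k\<^sub>1, k\<^sub>2] \<mapsto> [k\<^sub>1 h\<^sub>1, (k\<^sub>2 h\<^sub>1, h\<^sub>2)]\<close>. As a relation it allows any representatives and
any pairing; that it is the graph of an injective function is proved below.\<close>

definition extends_to :: "'m list set \<Rightarrow> 'm list set \<Rightarrow> bool" where
  "extends_to x y \<longleftrightarrow>
     (\<exists>k1 k2 t. tupling C (Id C H) {#k1, k2#} \<and> tupling C t {#k2 \<circ>\<^sub>C h1, h2#} \<and>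
        x = decomp C H [k1, k2] \<and> y = decomp C A [k1 \<circ>\<^sub>C h1, t])"

lemma extends_toI:
  assumes "tupling C (Id C H) {#k1, k2#}" "tupling C t {#k2 \<circ>\<^sub>C h1, h2#}"
  shows "extends_to (decomp C H [k1, k2]) (decomp C A [k1 \<circ>\<^sub>C h1, t])"
  unfolding extends_to_def by (rule exI conjI refl assms)+

lemma extends_toE:
  assumes "extends_to x y"
  obtains k1 k2 t where "tupling C (Id C H) {#k1, k2#}" "tupling C t {#k2 \<circ>\<^sub>C h1, h2#}"
    "x = decomp C H [k1, k2]" "y = decomp C A [k1 \<circ>\<^sub>C h1, t]"
  using assms unfolding extends_to_def by (elim exE conjE)

lemma extension_components:
  assumes k: "tupling C (Id C H) {#k1, k2#}" and t: "tupling C t {#k2 \<circ>\<^sub>C h1, h2#}"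
  shows "k1 \<in> Arr C" "k2 \<in> Arr C" "Dom C k1 = H" "Dom C k2 = H" "t \<in> Arr C" "Dom C t = A"
    "tupling C (Id C A) {#k1 \<circ>\<^sub>C h1, k2 \<circ>\<^sub>C h1, h2#}"
    "tupling C (Id C A) {#k1 \<circ>\<^sub>C h1, t#}"
proof -
  show dom: "k1 \<in> Arr C" "k2 \<in> Arr C" "Dom C k1 = H" "Dom C k2 = H" "t \<in> Arr C" "Dom C t = A"
    using tupling_Id_mem[OF H_Obj k] tupling_Arr[OF t] tupling_mem(2)[OF t, of h2] h_Arr by auto
  show 3: "tupling C (Id C A) {#k1 \<circ>\<^sub>C h1, k2 \<circ>\<^sub>C h1, h2#}"
    using tupling_expand[OF h tupling_h1[OF k], of "{#h2#}"] by (simp add: add_mset_commute)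
  show "tupling C (Id C A) {#k1 \<circ>\<^sub>C h1, t#}"
    using tupling_gather[OF 3 t, of "{#k1 \<circ>\<^sub>C h1#}"] dom A by (simp add: Id_in_Arr add_mset_commute)
qed

lemma extension_unique:
  assumes "extends_to x y" "extends_to x y'"
  shows "y = y'"
proof -
  obtain k1 k2 t where k: "tupling C (Id C H) {#k1, k2#}" and t: "tupling C t {#k2 \<circ>\<^sub>C h1, h2#}"
    and xy: "x = decomp C H [k1, k2]" "y = decomp C A [k1 \<circ>\<^sub>C h1, t]"
    using assms(1) by (rule extends_toE)
  obtain l1 l2 s where l: "tupling C (Id C H) {#l1, l2#}" and s: "tupling C s {#l2 \<circ>\<^sub>C h1, h2#}"
    and xy': "x = decomp C H [l1, l2]" "y' = decomp C A [l1 \<circ>\<^sub>C h1, s]"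
    using assms(2) by (rule extends_toE)
  note K = extension_components[OF k t] and L = extension_components[OF l s]
  have "arr_sim C k1 l1" "arr_sim C k2 l2" using decomp_eqD[OF H_Obj k l] xy xy' by auto
  then have sim: "arr_sim C (k1 \<circ>\<^sub>C h1) (l1 \<circ>\<^sub>C h1)" "arr_sim C (k2 \<circ>\<^sub>C h1) (l2 \<circ>\<^sub>C h1)"
    using arr_sim_comp K h_Arr H by auto
  have "arr_sim C t s"
    using tupling_unique[OF tupling_replace[OF t sim(2)] s] K L by simp
  with sim(1) show ?thesis unfolding xy xy' using comp_h1 K by (intro decomp_eqI)
qed

text \<open>Since \<open>h1\<close> is a pairing of \<open>k1 h1\<close> and \<open>k2 h1\<close>, and the second component of \<open>y\<close> one of \<open>h2\<close> and
\<open>k2 h1\<close>, both pairings are known, and they determine \<open>k2 h1\<close>. Cancelling the epimorphism \<open>h1\<close>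
recovers \<open>k1\<close> and \<open>k2\<close> up to \<open>\<simeq>\<close>.\<close>

lemma extension_inj:
  assumes "extends_to x y" "extends_to x' y"
  shows "x = x'"
proof -
  obtain k1 k2 t where k: "tupling C (Id C H) {#k1, k2#}" and t: "tupling C t {#k2 \<circ>\<^sub>C h1, h2#}"
    and xy: "x = decomp C H [k1, k2]" "y = decomp C A [k1 \<circ>\<^sub>C h1, t]"
    using assms(1) by (rule extends_toE)
  obtain l1 l2 s where l: "tupling C (Id C H) {#l1, l2#}" and s: "tupling C s {#l2 \<circ>\<^sub>C h1, h2#}"
    and xy': "x' = decomp C H [l1, l2]" "y = decomp C A [l1 \<circ>\<^sub>C h1, s]"
    using assms(2) by (rule extends_toE)
  note K = extension_components[OF k t] and L = extension_components[OF l s]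
  have sim: "arr_sim C (k1 \<circ>\<^sub>C h1) (l1 \<circ>\<^sub>C h1)" "arr_sim C t s"
    using decomp_eqD[OF A K(8) L(8)] xy(2) xy'(2) by auto
  have h1k: "tupling C h1 {#k1 \<circ>\<^sub>C h1, k2 \<circ>\<^sub>C h1#}" and h1l: "tupling C h1 {#l1 \<circ>\<^sub>C h1, l2 \<circ>\<^sub>C h1#}"
    using tupling_h1[OF k] tupling_h1[OF l] by simp_all
  have s': "tupling C s {#h2, k2 \<circ>\<^sub>C h1#}" "tupling C s {#h2, l2 \<circ>\<^sub>C h1#}"
    using tupling_sim[OF t sim(2)] s by (simp_all add: add_mset_commute)
  have "arr_sim C (k2 \<circ>\<^sub>C h1) (l2 \<circ>\<^sub>C h1)"
    using third_component_unique[OF A _ _ h1k h1l s'] K(7) L(7) by (simp add: add_mset_commute)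
  then have "arr_sim C k1 l1" "arr_sim C k2 l2"
    using epi_reflects_sim[OF h1_epi] sim(1) K L H by auto
  then show ?thesis unfolding xy xy' using K by (intro decomp_eqI)
qed

lemma extension_exists:
  assumes "x \<in> decomps C 2 H"
  obtains y where "extends_to x y"
proof -
  obtain k1 k2 where k: "tupling C (Id C H) {#k1, k2#}" "x = decomp C H [k1, k2]"
    using assms decomps_2_iff[OF H_Obj] by auto
  have "k2 \<in> Arr C" "Dom C k2 = H" using tupling_Id_mem[OF H_Obj k(1)] by auto
  then obtain t where t: "tupling C t {#k2 \<circ>\<^sub>C h1, h2#}"
    using pairing_exists[OF comp_h1(1) h_Arr(2) comp_h1(2) h_Arr(4)] by blast
  show thesis using that extends_toI[OF k(1) t] k(2) by simp
qed

lemma extends_to_closed: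
  assumes "extends_to x y"
  shows "x \<in> decomps C 2 H"
  using assms unfolding decomps_2_iff[OF H_Obj] by (elim extends_toE) (intro exI conjI)

text \<open>If \<open>y\<close> is a summand of \<open>[h1, h2]\<close>, the witnessing ternary diagram has \<open>(d1, d2) \<simeq> h1\<close>, so the legs of
a product diagram on \<open>H\<close> exhibit \<open>d1\<close> and \<open>d2\<close> as composites with \<open>h1\<close>. In the other direction the
complementary summand is \<open>[k2 h1, (k1 h1, h2)]\<close>.\<close>

lemma in_interval_iff_extension:
  "y \<in> oa_down (DA C A) (decomp C A [h1, h2]) \<longleftrightarrow> (\<exists>x. extends_to x y)"
proof -
  have down: "y \<in> oa_down (DA C A) (decomp C A [h1, h2]) \<longleftrightarrow> (\<exists>c. decomp_sum C A y c (decomp C A [h1, h2]))"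
  proof -
    have "oa_carrier (DA C A) = decomps C 2 A" by (simp add: DA_def)
    then show ?thesis unfolding oa_down_def oa_le_def DA_plus_iff[OF A]
      using decomp_sum_closed[OF A] by blast
  qed
  show ?thesis unfolding down
  proof (intro iffI; elim exE)
    fix c assume "decomp_sum C A y c (decomp C A [h1, h2])"
    with A obtain d1 d2 d3 a b e where d: "tupling C (Id C A) {#d1, d2, d3#}"
      and da: "tupling C a {#d2, d3#}" and de: "tupling C e {#d1, d2#}"
      and dy: "y = decomp C A [d1, a]" "decomp C A [h1, h2] = decomp C A [e, d3]"
      and dp: "tupling C (Id C A) {#e, d3#}"
      by (rule decomp_sumE)
    have sim: "arr_sim C e h1" "arr_sim C d3 h2" using decomp_eqD[OF A dp h dy(2)[symmetric]] by auto
    have "tupling C h1 {#d1, d2#}" using tupling_sim[OF de sim(1)] .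
    then obtain ks where ks: "product_diagram C H ks" "map (\<lambda>k. k \<circ>\<^sub>C h1) ks = [d1, d2]"
      using tupling_listE[of h1 "{#d1, d2#}" "[d1, d2]"] H by auto
    then obtain k1 k2 where k: "ks = [k1, k2]" "d1 = k1 \<circ>\<^sub>C h1" "d2 = k2 \<circ>\<^sub>C h1"
      by (auto simp: map_eq_Cons_conv)
    have "tupling C (Id C H) {#k1, k2#}" using ks(1) k(1) product_diagram_iff_tupling[OF H_Obj] by simp
    moreover have "tupling C a {#k2 \<circ>\<^sub>C h1, h2#}"
      using tupling_replace[of a d3 "{#d2#}" h2] da sim(2) k(3) by (simp add: add_mset_commute)
    ultimately show "\<exists>x. extends_to x y" unfolding dy(1) k(2)
      by (intro exI) (rule extends_toI)
  next
    fix x assume "extends_to x y"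
    then obtain k1 k2 t where k: "tupling C (Id C H) {#k1, k2#}" and t: "tupling C t {#k2 \<circ>\<^sub>C h1, h2#}"
      and y: "y = decomp C A [k1 \<circ>\<^sub>C h1, t]"
      by (rule extends_toE)
    note K = extension_components[OF k t]
    obtain b where b: "tupling C b {#k1 \<circ>\<^sub>C h1, h2#}"
      using pairing_exists[OF comp_h1(1) h_Arr(2) comp_h1(2) h_Arr(4)] K(1,3) by blast
    have "tupling C h1 {#k1 \<circ>\<^sub>C h1, k2 \<circ>\<^sub>C h1#}" using tupling_h1[OF k] by simp
    from decomp_sumI[OF A K(7) t b this] show "\<exists>c. decomp_sum C A y c (decomp C A [h1, h2])"
      unfolding y by blast
  qed
qed

text \<open>A ternary diagram on \<open>H\<close> and the ternary diagram \<open>(n1 h1, n2 h1, (n3 h1, h2))\<close> on \<open>A\<close> induce binary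
decompositions that correspond to each other. This serves for preservation and for reflection of
sums.\<close>

lemma ternary_extension:
  assumes n: "tupling C (Id C H) {#n1, n2, n3#}"
    and a0: "tupling C a0 {#n2, n3#}" and b0: "tupling C b0 {#n1, n3#}" and e0: "tupling C e0 {#n1, n2#}"
    and d3: "tupling C d3 {#n3 \<circ>\<^sub>C h1, h2#}"
    and a: "tupling C a {#n2 \<circ>\<^sub>C h1, d3#}" and b: "tupling C b {#n1 \<circ>\<^sub>C h1, d3#}"
  shows "extends_to (decomp C H [n1, a0]) (decomp C A [n1 \<circ>\<^sub>C h1, a])" (is ?thesis1)
    and "extends_to (decomp C H [n2, b0]) (decomp C A [n2 \<circ>\<^sub>C h1, b])" (is ?thesis2)
    and "extends_to (decomp C H [e0, n3]) (decomp C A [e0 \<circ>\<^sub>C h1, d3])" (is ?thesis3)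
proof -
  \<comment> \<open>Generalized over \<open>n1\<close> and \<open>n2\<close>, whose exchange gives the second claim.\<close>
  have ext: "extends_to (decomp C H [n1, a0]) (decomp C A [n1 \<circ>\<^sub>C h1, a])"
    if n: "tupling C (Id C H) {#n1, n2, n3#}" and a0: "tupling C a0 {#n2, n3#}"
      and a: "tupling C a {#n2 \<circ>\<^sub>C h1, d3#}" for n1 n2 a0 a
  proof -
    have n_Arr: "n2 \<in> Arr C" "Dom C n2 = H" using tupling_Id_mem[OF H_Obj n] by auto
    have dom: "Dom C a0 = H" "a0 \<in> Arr C" "Dom C a = A"
      using tupling_mem(2)[OF a0, of n2] tupling_Arr[OF a0] n_Arr tupling_mem(2)[OF a, of "n2 \<circ>\<^sub>C h1"] comp_h1(2)
      by auto
    have "tupling C (Id C H) {#n1, a0#}"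
      using tupling_gather[OF n a0, of "{#n1#}"] dom H_Obj by (simp add: Id_in_Arr add_mset_commute)
    moreover have "tupling C a {#n2 \<circ>\<^sub>C h1, n3 \<circ>\<^sub>C h1, h2#}"
      using tupling_expand[OF a d3, of "{#n2 \<circ>\<^sub>C h1#}"] by (simp add: add_mset_commute)
    then have "tupling C a {#a0 \<circ>\<^sub>C h1, h2#}"
      using tupling_gather[OF _ tupling_comp_h1[OF a0 dom(1)], of a _ "{#h2#}"] comp_h1[OF dom(2,1)] dom
      by (simp add: add_mset_commute)
    ultimately show ?thesis by (rule extends_toI)
  qed
  show ?thesis1 using ext n a0 a by blast
  show ?thesis2 using ext[of n2 n1 b0 b] n b0 b by (simp add: add_mset_commute)
  have dom: "Dom C e0 = H"
    using tupling_mem(2)[OF e0, of n1] tupling_Id_mem[OF H_Obj n, of n1] by simp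
  have "tupling C (Id C H) {#e0, n3#}"
    using tupling_gather[OF n e0, of "{#n3#}"] dom H_Obj by (simp add: Id_in_Arr add_mset_commute)
  from this d3 show ?thesis3 by (rule extends_toI)
qed

lemma extension_preserves_sum:
  assumes sum: "decomp_sum C H x y z"
    and x: "extends_to x x'" and y: "extends_to y y'" and z: "extends_to z z'"
  shows "decomp_sum C A x' y' z'"
proof -
  from H_Obj sum obtain n1 n2 n3 a0 b0 e0 where n: "tupling C (Id C H) {#n1, n2, n3#}"
    and n_Arr: "n1 \<in> Arr C" "n2 \<in> Arr C" "n3 \<in> Arr C" "Dom C n1 = H" "Dom C n2 = H" "Dom C n3 = H"
    and a0: "tupling C a0 {#n2, n3#}" and b0: "tupling C b0 {#n1, n3#}" and e0: "tupling C e0 {#n1, n2#}"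
    and e0_dom: "Dom C e0 = H"
    and xyz: "x = decomp C H [n1, a0]" "y = decomp C H [n2, b0]" "z = decomp C H [e0, n3]"
    by (rule decomp_sumE)
  note arr = comp_h1[OF n_Arr(1,4)] comp_h1[OF n_Arr(2,5)] comp_h1[OF n_Arr(3,6)]
  obtain d3 where d3: "tupling C d3 {#n3 \<circ>\<^sub>C h1, h2#}" "Dom C d3 = A"
    using pairing_exists[OF arr(5) h_Arr(2) arr(6) h_Arr(4)] .
  obtain a where a: "tupling C a {#n2 \<circ>\<^sub>C h1, d3#}"
    using pairing_exists[OF arr(3) tupling_Arr[OF d3(1)] arr(4) d3(2)] .
  obtain b where b: "tupling C b {#n1 \<circ>\<^sub>C h1, d3#}"
    using pairing_exists[OF arr(1) tupling_Arr[OF d3(1)] arr(2) d3(2)] .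
  have "tupling C h1 {#n1 \<circ>\<^sub>C h1, n2 \<circ>\<^sub>C h1, n3 \<circ>\<^sub>C h1#}" using tupling_h1[OF n] by simp
  from tupling_expand[OF h this refl]
  have 4: "tupling C (Id C A) {#n1 \<circ>\<^sub>C h1, n2 \<circ>\<^sub>C h1, n3 \<circ>\<^sub>C h1, h2#}" by (simp add: add_mset_commute)
  have 3: "tupling C (Id C A) {#n1 \<circ>\<^sub>C h1, n2 \<circ>\<^sub>C h1, d3#}"
    using tupling_gather[OF 4 d3(1), of "{#n1 \<circ>\<^sub>C h1, n2 \<circ>\<^sub>C h1#}"] d3 A
    by (simp add: Id_in_Arr add_mset_commute)
  have e: "tupling C (e0 \<circ>\<^sub>C h1) {#n1 \<circ>\<^sub>C h1, n2 \<circ>\<^sub>C h1#}" using tupling_comp_h1[OF e0 e0_dom] by simp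
  note ext = ternary_extension[OF n a0 b0 e0 d3(1) a b, folded xyz]
  show ?thesis
    using decomp_sumI[OF A 3 a b e] extension_unique[OF x ext(1)] extension_unique[OF y ext(2)]
      extension_unique[OF z ext(3)] by simp
qed

text \<open>Comparing the sum of the witness on \<open>A\<close> with \<open>z'\<close> shows \<open>(d1, d2) \<simeq> m1 h1\<close> and \<open>d3 \<simeq> (m2 h1, h2)\<close>. Hence
\<open>h1\<close> is a tupling of \<open>d1\<close>, \<open>d2\<close> and \<open>m2 h1\<close>, which gives a ternary diagram on \<open>H\<close>. The sum it witnesses
extends to the given one, so it is the required sum by injectivity.\<close>

lemma extension_reflects_sum:
  assumes sum: "decomp_sum C A x' y' z'"
    and x: "extends_to x x'" and y: "extends_to y y'" and z: "extends_to z z'"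
  shows "decomp_sum C H x y z"
proof -
  from A sum obtain d1 d2 d3 a b e where d: "tupling C (Id C A) {#d1, d2, d3#}"
    and a: "tupling C a {#d2, d3#}" and b: "tupling C b {#d1, d3#}" and e: "tupling C e {#d1, d2#}"
    and d_Arr: "d3 \<in> Arr C" and e_Arr: "e \<in> Arr C" "Dom C e = A"
    and x': "x' = decomp C A [d1, a]" and y': "y' = decomp C A [d2, b]" and z': "z' = decomp C A [e, d3]"
    and dp: "tupling C (Id C A) {#e, d3#}"
    by (rule decomp_sumE)
  obtain m1 m2 t where m: "tupling C (Id C H) {#m1, m2#}" and t: "tupling C t {#m2 \<circ>\<^sub>C h1, h2#}"
    and z'm: "z' = decomp C A [m1 \<circ>\<^sub>C h1, t]"
    using z by (rule extends_toE)
  note M = extension_components[OF m t]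
  have sim: "arr_sim C e (m1 \<circ>\<^sub>C h1)" "arr_sim C t d3"
    using decomp_eqD[OF A dp M(8)] decomp_eqD[OF A M(8) dp] z' z'm by auto
  have d3: "tupling C d3 {#m2 \<circ>\<^sub>C h1, h2#}" using tupling_sim[OF t sim(2)] .
  have m1: "tupling C (m1 \<circ>\<^sub>C h1) {#d1, d2#}" using tupling_sim[OF e sim(1)] .
  have "tupling C h1 {#m1 \<circ>\<^sub>C h1, m2 \<circ>\<^sub>C h1#}" using tupling_h1[OF m] by simp
  from tupling_expand[OF this m1 refl]
  have "tupling C h1 {#d1, d2, m2 \<circ>\<^sub>C h1#}" by (simp add: add_mset_commute)
  then obtain ns where ns: "product_diagram C H ns" "map (\<lambda>k. k \<circ>\<^sub>C h1) ns = [d1, d2, m2 \<circ>\<^sub>C h1]"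
    using tupling_listE[of h1 "{#d1, d2, m2 \<circ>\<^sub>C h1#}" "[d1, d2, m2 \<circ>\<^sub>C h1]"] H by auto
  then obtain n1 n2 n3 where nn: "ns = [n1, n2, n3]" "n1 \<circ>\<^sub>C h1 = d1" "n2 \<circ>\<^sub>C h1 = d2"
    "n3 \<circ>\<^sub>C h1 = m2 \<circ>\<^sub>C h1"
    by (auto simp: map_eq_Cons_conv)
  have n: "tupling C (Id C H) {#n1, n2, n3#}" using ns(1) nn(1) product_diagram_iff_tupling[OF H_Obj] by simp
  have n_Arr: "n1 \<in> Arr C" "n2 \<in> Arr C" "n3 \<in> Arr C" "Dom C n1 = H" "Dom C n2 = H" "Dom C n3 = H"
    using tupling_Id_mem[OF H_Obj n] by auto
  obtain a0 where a0: "tupling C a0 {#n2, n3#}" using pairing_exists[OF n_Arr(2,3,5,6)] .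
  obtain b0 where b0: "tupling C b0 {#n1, n3#}" using pairing_exists[OF n_Arr(1,3,4,6)] .
  obtain e0 where e0: "tupling C e0 {#n1, n2#}" "Dom C e0 = H" using pairing_exists[OF n_Arr(1,2,4,5)] .
  note ext = ternary_extension[OF n a0 b0 e0(1), of d3 a b, unfolded nn(2-4), OF d3 a b]
  have "tupling C (e0 \<circ>\<^sub>C h1) {#d1, d2#}" using tupling_comp_h1[OF e0] nn by simp
  then have "arr_sim C e (e0 \<circ>\<^sub>C h1)"
    using tupling_unique[OF e] e_Arr comp_h1(2)[OF tupling_Arr[OF e0(1)] e0(2)] by simp
  then have "z' = decomp C A [e0 \<circ>\<^sub>C h1, d3]"
    unfolding z' using e_Arr d_Arr by (intro decomp_eqI arr_sim_refl)
  with ext(3) have "z = decomp C H [e0, n3]" using extension_inj z by simp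
  moreover have "x = decomp C H [n1, a0]" "y = decomp C H [n2, b0]"
    using ext(1,2) x y extension_inj x' y' by simp_all
  ultimately show ?thesis using decomp_sumI[OF H_Obj n a0 b0 e0(1)] by simp
qed

lemma extension_zero:
  "extends_to (decomp C H [tau C H, Id C H]) (decomp C A [tau C A, Id C A])"
proof -
  have "tau C H \<circ>\<^sub>C h1 = tau C A"
    using tau(1-3)[OF H_Obj] h_Arr H by (intro tau(5)[OF A]) (auto simp: comp_in_Arr)
  moreover have "Id C H \<circ>\<^sub>C h1 = h1" using h_Arr(1) H by (rule comp_Id(2))
  moreover have "tupling C (Id C H) {#tau C H, Id C H#}"
    using tupling_Id_tau[OF H_Obj] by (simp add: add_mset_commute)
  ultimately show ?thesis using extends_toI[of "tau C H" "Id C H" "Id C A"] h by simp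
qed

lemma extension_one:
  "extends_to (decomp C H [Id C H, tau C H]) (decomp C A [h1, h2])"
proof -
  have "tau C H \<circ>\<^sub>C h1 = tau C A"
    using tau(1-3)[OF H_Obj] h_Arr H by (intro tau(5)[OF A]) (auto simp: comp_in_Arr)
  moreover have "Id C H \<circ>\<^sub>C h1 = h1" using h_Arr(1) H by (rule comp_Id(2))
  moreover have "tupling C h2 {#tau C A, h2#}"
    using tupling_add_tau[OF tupling_self[OF h_Arr(2)] h_Arr(4) A] .
  ultimately show ?thesis using extends_toI[OF tupling_Id_tau[OF H_Obj], of h2] by simp
qed

lemma interval_isomorphic:
  "oa_isomorphic (oa_interval (DA C A) (decomp C A [h1, h2])) (DA C H)"
proof -
  let ?E = extends_to and ?L = "oa_interval (DA C A) (decomp C A [h1, h2])"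
  define \<psi> where "\<psi> x = (THE y. ?E x y)" for x
  have \<psi>_eq: "\<psi> x = y" if "?E x y" for x y
    unfolding \<psi>_def using that by (rule the_equality) (rule extension_unique[OF _ that])
  have \<psi>: "?E x (\<psi> x)" if x: "x \<in> decomps C 2 H" for x
  proof -
    obtain y where y: "?E x y" using extension_exists[OF x] .
    then show ?thesis using \<psi>_eq[OF y] by simp
  qed
  have carrier: "oa_carrier (DA C H) = decomps C 2 H" by (simp add: DA_def)
  have carrier_L: "oa_carrier ?L = {y. \<exists>x. ?E x y}"
    using in_interval_iff_extension by (auto simp: oa_interval_def)
  have plus_L: "oa_plus ?L x' y' = Some z' \<longleftrightarrow> decomp_sum C A x' y' z' \<and> (\<exists>z. ?E z z')"
    if "?E x x'" "?E y y'" for x x' y y' z'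
  proof -
    have "x' \<in> oa_down (DA C A) (decomp C A [h1, h2])" "y' \<in> oa_down (DA C A) (decomp C A [h1, h2])"
      using that in_interval_iff_extension by auto
    then show ?thesis
      unfolding DA_plus_iff[OF A, symmetric] in_interval_iff_extension[symmetric]
      by (auto simp: oa_interval_def split: option.splits)
  qed
  show ?thesis
  proof (rule orthoalgebra_transport[where \<psi> = \<psi>])
    show "orthoalgebra (DA C H)" using H_Obj by (rule orthoalgebra_DA)
    have "inj_on \<psi> (decomps C 2 H)" 
    proof (rule inj_onI)
      fix x y assume "x \<in> decomps C 2 H" "y \<in> decomps C 2 H" "\<psi> x = \<psi> y"
      then show "x = y" using \<psi>[of x] \<psi>[of y] extension_inj[of x _ y] by simp
    qed
    moreover have "\<psi> ` decomps C 2 H = {y. \<exists>x. ?E x y}"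
    proof (intro set_eqI iffI; (elim imageE CollectE exE)?)
      show "y \<in> {y. \<exists>x. ?E x y}" if "y = \<psi> x" "x \<in> decomps C 2 H" for x y
        using \<psi>[OF that(2)] that(1) by blast
      show "y \<in> \<psi> ` decomps C 2 H" if "?E x y" for x y
        using extends_to_closed[OF that] \<psi>_eq[OF that] by blast
    qed
    ultimately show "bij_betw \<psi> (oa_carrier (DA C H)) (oa_carrier ?L)"
      unfolding carrier carrier_L by (simp add: bij_betw_def)
    show "\<psi> (oa_zero (DA C H)) = oa_zero ?L" "\<psi> (oa_one (DA C H)) = oa_one ?L"
      using \<psi>_eq[OF extension_zero] \<psi>_eq[OF extension_one] by (simp_all add: DA_def oa_interval_def)
    show "oa_plus ?L (\<psi> x) (\<psi> y) = map_option \<psi> (oa_plus (DA C H) x y)"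
      if xy: "x \<in> oa_carrier (DA C H)" "y \<in> oa_carrier (DA C H)" for x y
    proof -
      have E: "?E x (\<psi> x)" "?E y (\<psi> y)" using xy \<psi> carrier by auto
      have "oa_plus ?L (\<psi> x) (\<psi> y) = Some z' \<longleftrightarrow> map_option \<psi> (oa_plus (DA C H) x y) = Some z'" for z'
      proof
        assume "oa_plus ?L (\<psi> x) (\<psi> y) = Some z'"
        then obtain z where "decomp_sum C A (\<psi> x) (\<psi> y) z'" and z: "?E z z'" using plus_L[OF E] by blast
        then have "decomp_sum C H x y z" using extension_reflects_sum E by blast
        then have "oa_plus (DA C H) x y = Some z" by (simp only: DA_plus_iff[OF H_Obj])
        then show "map_option \<psi> (oa_plus (DA C H) x y) = Some z'"
          using \<psi>_eq[OF z] by simp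
      next
        assume "map_option \<psi> (oa_plus (DA C H) x y) = Some z'"
        then obtain z where z: "decomp_sum C H x y z" "z' = \<psi> z" using DA_plus_iff[OF H_Obj] by auto
        then have "?E z z'" using \<psi> decomp_sum_closed[OF H_Obj] by blast
        then show "oa_plus ?L (\<psi> x) (\<psi> y) = Some z'"
          using plus_L[OF E] extension_preserves_sum[OF z(1) E] by blast
      qed
      then show ?thesis by (metis not_Some_eq)
    qed
  qed
qed

end

theorem theorem4p1:
  fixes C :: "('o, 'm) category" and A H1 H2 :: 'o and h1 h2 :: 'm
  assumes "strongly_honest C"
    and "A \<in> Obj C"
    and "in_hom C h1 A H1" and "in_hom C h2 A H2"
    and "product_diagram C A [h1, h2]"
  shows "oa_isomorphic (oa_interval (DA C A) (decomp C A [h1, h2])) (DA C H1)"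
proof -
  interpret strongly_honest_category C
    using assms(1) by (auto simp: strongly_honest_category_def strongly_honest_category_axioms_def
        strongly_honest_def)
  interpret binary_decomposition C A H1 h1 h2
    using assms product_diagram_iff_tupling[OF assms(2), of "[h1, h2]"]
    by unfold_locales (auto simp: in_hom_def)
  show ?thesis by (rule interval_isomorphic)
qed

end
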